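(* Let $f:\overline{\Omega}\times\mathbb{R}\to\mathbb{R}$ be continuous (jointly in both variables) and satisfy the following three conditions. (a) $\displaystyle\lim_{|s|\to\infty}\frac{\max_{x\in\overline{\Omega}}|f(x,s)|}{|s|^{2^*-1}}=0$. (b) There is a constant $c_0>0$ such that $\displaystyle\limsup_{s\to+\infty}\frac{\max_{\overline{\Omega}\times[-s,s]}|f|}{\max_{\overline{\Omega}\times\{-s,s\}}|f|}\le c_0$. (c) There are constants $M_0>0$ and $s_0>0$ such that $\max_{x\in\overline{\Omega}}|f(x,s)|>M_0$ for all $|s|>s_0$. Define $h(s):=\dfrac{|s|^{2^*-1}}{\max_{\overline{\Omega}\times\{-s,s\}}|f|}$ for $|s|>s_0$. Then there exists a constant $C_1>0$, independent of $u$, such that for every weak solution $u\in H_0^1(\Omega)\cap L^\infty(\Omega)$ of $-\Delta u=f(x,u)$ in $\Omega$, $u=0$ on $\partial\Omega$, one of the following holds: (i) either $\|u\|_\infty\le C_1$; or (ii) for every $\theta\in(0,1]$, $$h\big(\|u\|_\infty\big)\le C\,\big(\|u\|_{2^*}\big)^{\frac{N+2}{N-2}\cdot\frac{2(1-\theta)}{N-2\theta}}\Big(\|f(\cdot,u)\|_{\frac{2N}{N+2}}\Big)^{\frac{2(1+\theta)}{N-2\theta}},$$ where $C$ depends only on $\Omega$, $\theta$ and $N$ and is independent of the solution $u$. In particular (for $\theta=1$), $$h\big(\|u\|_\infty\big)\le C\,\Big(\|f(\cdot,u)\|_{\frac{2N}{N+2}}\Big)^{\frac{4}{N-2}},$$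 where $C$ depends only on $\Omega$ and $N$ and is independent of $u$.
   Context: $N>2$; $\Omega\subset\mathbb{R}^N$ is a bounded, connected open set with $C^{2,\alpha}$ boundary $\partial\Omega$. $2^*=\frac{2N}{N-2}$ is the critical Sobolev exponent, so $2^*-1=\frac{N+2}{N-2}$. $\|\cdot\|_p$ is the $L^p(\Omega)$ norm. A weak solution of $-\Delta u=f(x,u)$ in $\Omega$, $u=0$ on $\partial\Omega$, is a function $u\in H_0^1(\Omega)$ with $f(\cdot,u)\in L^1_{loc}(\Omega)$ and $\int_\Omega\nabla u\cdot\nabla\varphi\,dx=\int_\Omega f(x,u)\varphi\,dx$ for all $\varphi\in C_c^\infty(\Omega)$. No sign condition is imposed on $u$. In alternative (ii) it is understood that $\|u\|_\infty>s_0$, so that $h(\|u\|_\infty)$ is defined.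
   Formalization: The constant C is allowed to depend on c_0 as well as on Ω, θ and N (it is still independent of u and uniform over all f satisfying the conditions with that c_0); a constant C independent of c_0 does not exist in general. *)

theory Defs
  imports "HOL-Analysis.Analysis" "HOL-Probability.Essential_Supremum"
begin

section \<open>Domains with Hoelder regular boundary\<close>

definition C2_holder_on :: "real \<Rightarrow> (real^'n) set \<Rightarrow> (real^'n \<Rightarrow> real) \<Rightarrow> bool" where
  "C2_holder_on \<alpha> S g \<longleftrightarrow>
     (\<exists>(g1 :: real^'n \<Rightarrow> (real^'n) \<Rightarrow>\<^sub>L real) (g2 :: real^'n \<Rightarrow> (real^'n) \<Rightarrow>\<^sub>L ((real^'n) \<Rightarrow>\<^sub>L real)) L.
        (\<forall>x\<in>S. (g has_derivative blinfun_apply (g1 x)) (at x)) \<and>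
        (\<forall>x\<in>S. (g1 has_derivative blinfun_apply (g2 x)) (at x)) \<and>
        (\<forall>x\<in>S. \<forall>y\<in>S. norm (g2 x - g2 y) \<le> L * norm (x - y) powr \<alpha>))"

text \<open>Near each boundary point the domain lies strictly on one side of the graph of a
  \<open>C\<^sup>2\<^sup>,\<^sup>\<alpha>\<close> function of \<open>N - 1\<close> variables. With \<open>\<nu>\<close> the direction of the vertical axis (after a
  rotation of the coordinates), a function on the hyperplane orthogonal to \<open>\<nu>\<close> is encoded as a
  function on the whole space that is invariant under translations along \<open>\<nu>\<close>.\<close>

definition C2_holder_boundary :: "real \<Rightarrow> (real^'n) set \<Rightarrow> bool" where
  "C2_holder_boundary \<alpha> \<Omega> \<longleftrightarrow>
     (\<forall>p\<in>frontier \<Omega>. \<exists>r>0. \<exists>\<nu> \<gamma>.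
        norm \<nu> = 1 \<and>
        (\<forall>x t. \<gamma> (x + t *\<^sub>R \<nu>) = \<gamma> x) \<and>
        C2_holder_on \<alpha> (ball p r) \<gamma> \<and>
        \<Omega> \<inter> ball p r = {x \<in> ball p r. \<gamma> x < x \<bullet> \<nu>})"

section \<open>Test functions\<close>

definition partial_deriv :: "'n::finite \<Rightarrow> (real^'n \<Rightarrow> real) \<Rightarrow> real^'n \<Rightarrow> real" where
  "partial_deriv i g x = frechet_derivative g (at x) (axis i 1)"

definition grad :: "(real^'n \<Rightarrow> real) \<Rightarrow> real^'n \<Rightarrow> real^'n" where
  "grad g x = (\<chi> i. partial_deriv i g x)"

primrec Ck :: "nat \<Rightarrow> (real^'n \<Rightarrow> real) \<Rightarrow> bool" where
  "Ck 0 g \<longleftrightarrow> continuous_on UNIV g"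
| "Ck (Suc k) g \<longleftrightarrow> g differentiable_on UNIV \<and> (\<forall>i. Ck k (partial_deriv i g))"

definition test_functions :: "(real^'n) set \<Rightarrow> (real^'n \<Rightarrow> real) set" where
  "test_functions \<Omega> =
     {\<phi>. (\<forall>k. Ck k \<phi>) \<and> compact (closure {x. \<phi> x \<noteq> 0}) \<and> closure {x. \<phi> x \<noteq> 0} \<subseteq> \<Omega>}"

section \<open>Lebesgue and Sobolev spaces\<close>

definition loc_integrable :: "(real^'n) set \<Rightarrow> (real^'n \<Rightarrow> 'b::euclidean_space) \<Rightarrow> bool" where
  "loc_integrable \<Omega> v \<longleftrightarrow> (\<forall>K. compact K \<and> K \<subseteq> \<Omega> \<longrightarrow> integrable (lebesgue_on K) v)"

definition square_integrable :: "(real^'n) set \<Rightarrow> (real^'n \<Rightarrow> 'b::euclidean_space) \<Rightarrow> bool" where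
  "square_integrable \<Omega> v \<longleftrightarrow>
     v \<in> borel_measurable (lebesgue_on \<Omega>) \<and> integrable (lebesgue_on \<Omega>) (\<lambda>x. (norm (v x))\<^sup>2)"

text \<open>For real \<open>p > 0\<close>. The value is meaningful only if \<open>\<bar>v\<bar>\<^sup>p\<close> is integrable over \<open>\<Omega>\<close>; this is the case
  for every essentially bounded measurable \<open>v\<close> when \<open>\<Omega>\<close> is bounded.\<close>

definition Lp_norm :: "(real^'n) set \<Rightarrow> real \<Rightarrow> (real^'n \<Rightarrow> real) \<Rightarrow> real" where
  "Lp_norm \<Omega> p v = (\<integral>x. \<bar>v x\<bar> powr p \<partial>lebesgue_on \<Omega>) powr (1 / p)"

definition Linf :: "(real^'n) set \<Rightarrow> (real^'n \<Rightarrow> real) set" where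
  "Linf \<Omega> = {v. v \<in> borel_measurable (lebesgue_on \<Omega>) \<and>
                esssup (lebesgue_on \<Omega>) (\<lambda>x. ereal \<bar>v x\<bar>) < \<infinity>}"

definition Linf_norm :: "(real^'n) set \<Rightarrow> (real^'n \<Rightarrow> real) \<Rightarrow> real" where
  "Linf_norm \<Omega> v = real_of_ereal (esssup (lebesgue_on \<Omega>) (\<lambda>x. ereal \<bar>v x\<bar>))"

definition has_weak_grad :: "(real^'n) set \<Rightarrow> (real^'n \<Rightarrow> real) \<Rightarrow> (real^'n \<Rightarrow> real^'n) \<Rightarrow> bool" where
  "has_weak_grad \<Omega> v g \<longleftrightarrow>
     loc_integrable \<Omega> v \<and> loc_integrable \<Omega> g \<and>
     (\<forall>\<phi>\<in>test_functions \<Omega>. \<forall>i.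
        (\<integral>x. v x * partial_deriv i \<phi> x \<partial>lebesgue_on \<Omega>) = - (\<integral>x. g x $ i * \<phi> x \<partial>lebesgue_on \<Omega>))"

text \<open>A weak gradient is unique up to null sets, so the choice below is immaterial.\<close>

definition weak_grad :: "(real^'n) set \<Rightarrow> (real^'n \<Rightarrow> real) \<Rightarrow> real^'n \<Rightarrow> real^'n" where
  "weak_grad \<Omega> v = (SOME g. has_weak_grad \<Omega> v g)"

definition H1 :: "(real^'n) set \<Rightarrow> (real^'n \<Rightarrow> real) set" where
  "H1 \<Omega> = {v. square_integrable \<Omega> v \<and> (\<exists>g. has_weak_grad \<Omega> v g) \<and>
              square_integrable \<Omega> (weak_grad \<Omega> v)}"

text \<open>The closure of the test functions in \<open>H\<^sup>1\<close>.\<close>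

definition H10 :: "(real^'n) set \<Rightarrow> (real^'n \<Rightarrow> real) set" where
  "H10 \<Omega> = {v \<in> H1 \<Omega>. \<exists>\<phi>. (\<forall>k::nat. \<phi> k \<in> test_functions \<Omega>) \<and>
     (\<lambda>k. \<integral>x. (v x - \<phi> k x)\<^sup>2 \<partial>lebesgue_on \<Omega>) \<longlonglongrightarrow> 0 \<and>
     (\<lambda>k. \<integral>x. (norm (weak_grad \<Omega> v x - grad (\<phi> k) x))\<^sup>2 \<partial>lebesgue_on \<Omega>) \<longlonglongrightarrow> 0}"

text \<open>Weak solutions of \<open>-\<Delta>u = f(x,u)\<close> in \<open>\<Omega>\<close>, \<open>u = 0\<close> on the boundary.\<close>

definition weak_solution ::
    "(real^'n) set \<Rightarrow> (real^'n \<Rightarrow> real \<Rightarrow> real) \<Rightarrow> (real^'n \<Rightarrow> real) \<Rightarrow> bool" where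
  "weak_solution \<Omega> f u \<longleftrightarrow>
     u \<in> H10 \<Omega> \<and> loc_integrable \<Omega> (\<lambda>x. f x (u x)) \<and>
     (\<forall>\<phi>\<in>test_functions \<Omega>.
        (\<integral>x. weak_grad \<Omega> u x \<bullet> grad \<phi> x \<partial>lebesgue_on \<Omega>) = (\<integral>x. f x (u x) * \<phi> x \<partial>lebesgue_on \<Omega>))"

section \<open>Growth of the nonlinearity\<close>

text \<open>The critical Sobolev exponent \<open>2\<^sup>*\<close>, as a function of the dimension \<open>N > 2\<close>.\<close>

definition crit_exp :: "real \<Rightarrow> real" where
  "crit_exp N = 2 * N / (N - 2)"

text \<open>The maximum of \<open>\<bar>f\<bar>\<close> over \<open>closure \<Omega> \<times> T\<close>; for \<open>f\<close> continuous on \<open>closure \<Omega> \<times> UNIV\<close>, \<open>\<Omega>\<close> bounded and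
  nonempty and \<open>T\<close> compact and nonempty, the supremum is attained.\<close>

definition max_abs :: "(real^'n) set \<Rightarrow> (real^'n \<Rightarrow> real \<Rightarrow> real) \<Rightarrow> real set \<Rightarrow> real" where
  "max_abs \<Omega> f T = (SUP (x, s) \<in> closure \<Omega> \<times> T. \<bar>f x s\<bar>)"

definition h_fun :: "(real^'n) set \<Rightarrow> (real^'n \<Rightarrow> real \<Rightarrow> real) \<Rightarrow> real \<Rightarrow> real" where
  "h_fun \<Omega> f s = \<bar>s\<bar> powr (crit_exp (real CARD('n)) - 1) / max_abs \<Omega> f {-s, s}"

end

theory Submission
  imports Defs "HOL-Computational_Algebra.Polynomial"
begin

text \<open>
Let \<open>q = 2N / (N - 2)\<close> be the critical exponent, \<open>u\<close> a bounded weak solution, \<open>m\<close> its supremum norm, \<open>U\<close> its \<open>L\<^sup>q\<close>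
norm, \<open>F\<close> the Lebesgue norm of \<open>f(\<cdot>,u)\<close> for the exponent \<open>2N / (N + 2)\<close>, which is dual to \<open>q\<close>, and \<open>K\<close> the maximum of \<open>\<bar>f\<bar>\<close>
over all \<open>x\<close> and all \<open>\<bar>s\<bar> \<le> m\<close>. The theorem follows from two inequalities for the linear problem \<open>-\<Delta>u = g\<close>
with \<open>\<bar>g\<bar> \<le> K\<close>, whose constants depend on \<open>N\<close> only:

\<^item> \<open>m powr (q - 1) \<le> E * K * U powr (q - 2)\<close> (lemma \<open>sup_norm_bound\<close>),
\<^item> \<open>U \<le> S * F\<close> (lemma \<open>solution_norm_le_source_norm\<close>).

Indeed, the hypothesis on the upper limit gives \<open>K \<le> (c0 + 1) max_abs \<Omega> f {-m, m}\<close> once \<open>m\<close> is large, so the first inequality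
says that \<open>h(m)\<close> is at most a constant times \<open>U powr (q - 2)\<close>. The two exponents in the assertion add up to
\<open>q - 2 = 4 / (N - 2)\<close> for every \<open>\<theta>\<close>, and the second inequality allows one to exchange a part of the power of \<open>U\<close>
for a power of \<open>F\<close>.

The second inequality is the equation tested with \<open>u\<close>, combined with Hoelder and Sobolev. The first one is
Stampacchia's truncation method: the equation is tested with the part of \<open>u\<close> above a level \<open>k\<close>, and
Sobolev turns the result into the estimate
\<open>\<bar>{u > h}\<bar> \<le> (c K / (h - k)) powr q * \<bar>{u > k}\<bar> powr (q - 1)\<close> for \<open>h > k\<close> (lemma \<open>superlevel_step\<close>). Since \<open>q - 1 > 1\<close>,
an iteration over increasing levels shows that \<open>u\<close> cannot exceed a starting level \<open>k\<close> by more than a constant times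
\<open>K \<bar>{u > k}\<bar> powr (2 / N)\<close> (lemma \<open>upper_bound\<close>). With \<open>k = m / 2\<close> and Chebyshev's inequality for \<open>\<bar>{u > k}\<bar>\<close> this is
the first inequality, with the right powers because every step is invariant under scaling.

Two tools carry these steps. The Sobolev inequality for the exponent two is derived from the
Gagliardo-Nirenberg inequality for the exponent one, and the latter from an inequality on integrals along the lines
of a grid, proved by induction on the number of coordinates. Nonlinear test functions \<open>G(u)\<close> are
obtained as limits of \<open>G(\<phi>\<^sub>k)\<close>, with test functions \<open>\<phi>\<^sub>k\<close> that approximate \<open>u\<close>; the truncations \<open>G\<close> are chosen
smooth so that \<open>G(\<phi>\<^sub>k)\<close> is again a test function.
\<close>

section \<open>Powers and the Hoelder inequality for nonnegative integrals\<close>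

text \<open>The convention \<open>epow x 0 = 1\<close> also for \<open>x = 0\<close> and \<open>x = \<infinity>\<close> matters: in the grid-lines inequality an
exponent reaches zero exactly in the case that gives the Sobolev inequality, and the corresponding
factor then has to disappear.\<close>

definition epow :: "ennreal \<Rightarrow> real \<Rightarrow> ennreal" where
  "epow x a = (if a = 0 then 1 else if x = top then top else ennreal (enn2real x powr a))"

lemma epow_measurable [measurable (raw)]:
  assumes [measurable]: "f \<in> borel_measurable M"
  shows "(\<lambda>x. epow (f x) a) \<in> borel_measurable M"
  unfolding epow_def by measurable

lemma epow_0 [simp]: "epow x 0 = 1"
  by (simp add: epow_def)

lemma epow_zero [simp]: "a \<noteq> 0 \<Longrightarrow> epow 0 a = 0"
  by (simp add: epow_def)

lemma epow_ennreal: "0 \<le> r \<Longrightarrow> a \<noteq> 0 \<Longrightarrow> epow (ennreal r) a = ennreal (r powr a)"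
  by (simp add: epow_def)

lemma epow_eq_0_iff: "epow x a = 0 \<longleftrightarrow> x = 0 \<and> a \<noteq> 0"
  by (cases x) (auto simp: epow_def)

lemma epow_eq_top_iff: "epow x a = top \<longleftrightarrow> x = top \<and> a \<noteq> 0"
  by (cases x) (auto simp: epow_def)

lemma epow_mono: "0 \<le> a \<Longrightarrow> x \<le> y \<Longrightarrow> epow x a \<le> epow y a"
  by (cases x; cases y) (auto simp: epow_def top_unique intro!: ennreal_leI powr_mono2)

lemma epow_add: "0 \<le> a \<Longrightarrow> 0 \<le> b \<Longrightarrow> epow x (a + b) = epow x a * epow x b"
  by (cases x) (auto simp: epow_def ennreal_mult[symmetric] powr_add ennreal_mult_top ennreal_top_mult)

lemma epow_mult_nat: "0 \<le> a \<Longrightarrow> epow x (real n * a) = epow x a ^ n"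
  by (induction n) (auto simp: distrib_right epow_add)

text \<open>Convexity of the exponential function, applied to the logarithms.\<close>

lemma weighted_arith_geom_mean:
  fixes x a :: "'i \<Rightarrow> real"
  assumes "finite J" "J \<noteq> {}" and x: "\<And>j. j \<in> J \<Longrightarrow> 0 \<le> x j" and a: "\<And>j. j \<in> J \<Longrightarrow> 0 \<le> a j"
    and s: "(\<Sum>j\<in>J. a j) = 1"
  shows "(\<Prod>j\<in>J. x j powr a j) \<le> (\<Sum>j\<in>J. a j * x j)"
proof (cases "\<exists>j\<in>J. x j = 0")
  case True
  then have "(\<Prod>j\<in>J. x j powr a j) = 0"
    using \<open>finite J\<close> by (auto intro!: prod_zero)
  then show ?thesis
    using x a by (auto intro!: sum_nonneg)
next
  case False
  then have pos: "\<And>j. j \<in> J \<Longrightarrow> 0 < x j"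
    using x by force
  have "(\<Prod>j\<in>J. x j powr a j) = exp (\<Sum>j\<in>J. a j *\<^sub>R ln (x j))"
    unfolding exp_sum[OF \<open>finite J\<close>] using pos by (intro prod.cong) (auto simp: powr_def less_imp_neq[symmetric])
  also have "\<dots> \<le> (\<Sum>j\<in>J. a j * exp (ln (x j)))"
    by (rule convex_on_sum[OF assms(1,2) exp_convex s a]) auto
  also have "\<dots> = (\<Sum>j\<in>J. a j * x j)"
    using pos by (intro sum.cong) auto
  finally show ?thesis .
qed

text \<open>After division of each \<open>f j\<close> by its integral, the pointwise arithmetic-geometric mean inequality
integrates to the claim. The degenerate cases come first: if one integral vanishes then so does the
product, and otherwise one infinite integral makes the right-hand side infinite.\<close>

lemma Holder_nn_integral_prod:
  fixes f :: "'i \<Rightarrow> 'a \<Rightarrow> ennreal" and a :: "'i \<Rightarrow> real"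
  assumes J: "finite J" and [measurable]: "\<And>j. j \<in> J \<Longrightarrow> f j \<in> borel_measurable M"
    and a: "\<And>j. j \<in> J \<Longrightarrow> 0 \<le> a j" and s: "(\<Sum>j\<in>J. a j) = 1"
  shows "(\<integral>\<^sup>+x. (\<Prod>j\<in>J. epow (f j x) (a j)) \<partial>M) \<le> (\<Prod>j\<in>J. epow (\<integral>\<^sup>+x. f j x \<partial>M) (a j))"
proof -
  define L where "L = {j\<in>J. a j \<noteq> 0}"
  have L: "finite L" "L \<subseteq> J" and ap: "\<And>j. j \<in> L \<Longrightarrow> 0 < a j"
    using J a by (force simp: L_def)+
  have an: "\<And>j. j \<in> L \<Longrightarrow> a j \<noteq> 0"
    by (simp add: L_def)
  have sL: "(\<Sum>j\<in>L. a j) = 1"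
    unfolding s[symmetric] L_def using J by (intro sum.mono_neutral_left) auto
  then have "L \<noteq> {}" by auto
  have restr: "(\<Prod>j\<in>J. epow (g j) (a j)) = (\<Prod>j\<in>L. epow (g j) (a j))" for g
    using J unfolding L_def by (intro prod.mono_neutral_right) auto
  define I where "I j = (\<integral>\<^sup>+x. f j x \<partial>M)" for j
  have mf: "\<And>j. j \<in> L \<Longrightarrow> f j \<in> borel_measurable M"
    using L by auto
  have "(\<integral>\<^sup>+x. (\<Prod>j\<in>L. epow (f j x) (a j)) \<partial>M) \<le> (\<Prod>j\<in>L. epow (I j) (a j))"
  proof (cases "\<exists>j\<in>L. I j = 0")
    case True
    then obtain j where j: "j \<in> L" "I j = 0" by auto
    then have "AE x in M. f j x = 0"
      using mf[OF j(1)] by (simp add: I_def nn_integral_0_iff_AE)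
    then have "AE x in M. (\<Prod>j\<in>L. epow (f j x) (a j)) = 0"
    proof eventually_elim
      case (elim x)
      then show ?case
        using j(1) ap[OF j(1)] L(1) by (intro prod_zero) (auto intro!: bexI[of _ j])
    qed
    then have "(\<integral>\<^sup>+x. (\<Prod>j\<in>L. epow (f j x) (a j)) \<partial>M) = (\<integral>\<^sup>+x. 0 \<partial>M)"
      by (rule nn_integral_cong_AE)
    then show ?thesis by simp
  next
    case I0: False
    show ?thesis
    proof (cases "\<exists>j\<in>L. I j = top")
      case True
      then obtain j where j: "j \<in> L" "I j = top" by auto
      have "(\<Prod>j\<in>L. epow (I j) (a j)) = top"
        unfolding ennreal_prod_eq_top using j ap[OF j(1)] L I0 by (auto simp: epow_eq_0_iff epow_eq_top_iff)
      then show ?thesis by simp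
    next
      case False
      define c where "c j = enn2real (I j)" for j
      have c: "I j = ennreal (c j)" "0 < c j" if "j \<in> L" for j
      proof -
        have "I j \<noteq> top" "I j \<noteq> 0" using False I0 that by auto
        then show "I j = ennreal (c j)" "0 < c j"
          unfolding c_def by (simp_all add: enn2real_positive_iff top.not_eq_extremum zero_less_iff_neq_zero)
      qed
      have P: "(\<Prod>j\<in>L. epow (I j) (a j)) = ennreal (\<Prod>j\<in>L. c j powr a j)"
        using c an by (subst prod_ennreal[symmetric]) (auto intro!: prod.cong epow_ennreal simp: less_imp_le)
      have Ppos: "0 < (\<Prod>j\<in>L. c j powr a j)"
        using c by (intro prod_pos) (auto dest: c(2))
      have ptw: "(\<Prod>j\<in>L. epow (f j x) (a j)) \<le> ennreal (\<Prod>j\<in>L. c j powr a j) * (\<Sum>j\<in>L. ennreal (a j / c j) * f j x)"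
        for x
      proof (cases "\<exists>j\<in>L. f j x = top")
        case True
        then obtain j where j: "j \<in> L" "f j x = top" by auto
        have "ennreal (a j / c j) * f j x = top"
          using j ap[OF j(1)] c(2)[OF j(1)] by (simp add: ennreal_mult_top)
        then have "(\<Sum>j\<in>L. ennreal (a j / c j) * f j x) = top"
          using j(1) L(1) by (auto simp: ennreal_sum_eq_top)
        then show ?thesis
          using Ppos by (simp add: ennreal_mult_top)
      next
        case False
        define r where "r j = enn2real (f j x)" for j
        have r: "f j x = ennreal (r j)" "0 \<le> r j" if "j \<in> L" for j
          using False that by (auto simp: r_def top.not_eq_extremum)
        have "(\<Prod>j\<in>L. r j powr a j) = (\<Prod>j\<in>L. c j powr a j) * (\<Prod>j\<in>L. (r j / c j) powr a j)"
          unfolding prod.distrib[symmetric] using c r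
          by (intro prod.cong refl) (auto simp: powr_divide less_imp_neq[symmetric] dest!: c(2))
        also have "\<dots> \<le> (\<Prod>j\<in>L. c j powr a j) * (\<Sum>j\<in>L. a j * (r j / c j))"
          using \<open>L \<noteq> {}\<close> L r c ap sL Ppos
          by (intro mult_left_mono weighted_arith_geom_mean) (auto simp: less_imp_le)
        finally have "ennreal (\<Prod>j\<in>L. r j powr a j) \<le> ennreal ((\<Prod>j\<in>L. c j powr a j) * (\<Sum>j\<in>L. a j / c j * r j))"
          by (intro ennreal_leI) simp
        also have "\<dots> = ennreal (\<Prod>j\<in>L. c j powr a j) * (\<Sum>j\<in>L. ennreal (a j / c j) * f j x)"
          using Ppos r c ap
          by (subst ennreal_mult) (auto simp: ennreal_mult[symmetric] less_imp_le intro!: sum_nonneg arg_cong2[where f="(*)"]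
             simp del: sum_ennreal simp add: sum_ennreal[symmetric])
        also have "ennreal (\<Prod>j\<in>L. r j powr a j) = (\<Prod>j\<in>L. epow (f j x) (a j))"
          using r ap by (subst prod_ennreal[symmetric]) (auto intro!: prod.cong simp: epow_ennreal less_imp_neq[symmetric] dest!: ap)
        finally show ?thesis .
      qed
      have "(\<integral>\<^sup>+x. (\<Prod>j\<in>L. epow (f j x) (a j)) \<partial>M) \<le>
          (\<integral>\<^sup>+x. ennreal (\<Prod>j\<in>L. c j powr a j) * (\<Sum>j\<in>L. ennreal (a j / c j) * f j x) \<partial>M)"
        by (intro nn_integral_mono ptw)
      also have "\<dots> = ennreal (\<Prod>j\<in>L. c j powr a j) * (\<Sum>j\<in>L. ennreal (a j / c j) * I j)"
        using mf unfolding I_def by (simp add: nn_integral_cmult nn_integral_sum)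
      also have "(\<Sum>j\<in>L. ennreal (a j / c j) * I j) = (\<Sum>j\<in>L. ennreal (a j))"
        using c ap by (intro sum.cong refl) (auto simp: ennreal_mult[symmetric] less_imp_le less_imp_neq[symmetric] dest!: c)
      also have "\<dots> = 1"
        using sL ap by (subst sum_ennreal) (auto simp: less_imp_le)
      finally show ?thesis
        by (simp add: P)
    qed
  qed
  then show ?thesis
    unfolding restr I_def .
qed

section \<open>The grid-lines inequality\<close>

text \<open>Each \<open>\<integral> f (x(i := y)) dy\<close> is the integral of \<open>f\<close> along a grid line through \<open>x\<close>. Every factor on the left
is homogeneous in \<open>f\<close> and the degrees add up to \<open>1 + p\<close>. This is what makes an induction over the
coordinates possible: integrate first over the new coordinate \<open>i\<close>, pull the factor belonging to \<open>i\<close>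
out, and apply Hoelder to the others, whose exponents, \<open>1 - s p\<close> once and \<open>p\<close> for each of the \<open>s\<close> old coordinates, add up to one.
What remains is the same expression for the marginal \<open>F\<close> of \<open>f\<close> in one dimension less.\<close>

theorem grid_lines_inequality:
  fixes p :: real and f :: "('i \<Rightarrow> real) \<Rightarrow> ennreal"
  assumes "finite I" "0 < p" "(real (card I) - 1) * p \<le> 1"
    and "f \<in> borel_measurable (\<Pi>\<^sub>M i\<in>I. lborel)"
  shows "(\<integral>\<^sup>+x. epow (f x) (1 - (real (card I) - 1) * p) *
            (\<Prod>i\<in>I. epow (\<integral>\<^sup>+y. f (x(i := y)) \<partial>lborel) p) \<partial>(\<Pi>\<^sub>M i\<in>I. lborel))
         \<le> epow (\<integral>\<^sup>+x. f x \<partial>(\<Pi>\<^sub>M i\<in>I. lborel)) (1 + p)"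
  using assms
proof (induction I arbitrary: f rule: finite_induct)
  case empty
  then show ?case
    by (simp add: PiM_empty nn_integral_count_space_finite)
next
  case (insert i I)
  interpret product_sigma_finite "\<lambda>_::'i. lborel :: real measure"
    by standard
  note [measurable] = insert.prems(3)
  let ?M = "\<Pi>\<^sub>M i\<in>I. (lborel :: real measure)"
  let ?M' = "\<Pi>\<^sub>M i\<in>insert i I. (lborel :: real measure)"
  define s where "s = real (card I)"
  have card: "real (card (insert i I)) - 1 = s"
    using insert.hyps by (simp add: s_def)
  have sp: "s * p \<le> 1" "0 \<le> s" and p: "0 < p"
    using insert.prems insert.hyps by (auto simp: s_def)
  then have "(s - 1) * p \<le> 1"
    by (simp add: algebra_simps)
  define F where "F x = (\<integral>\<^sup>+y. f (x(i := y)) \<partial>lborel)" for x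
  have upd [measurable]: "(\<lambda>(x, y). x(i := y)) \<in> ?M \<Otimes>\<^sub>M lborel \<rightarrow>\<^sub>M ?M'"
    by (rule measurable_add_dim)
  have F_meas [measurable]: "F \<in> borel_measurable ?M"
    unfolding F_def by measurable
  have IH: "(\<integral>\<^sup>+x. epow (F x) (1 - (s - 1) * p) * (\<Prod>j\<in>I. epow (\<integral>\<^sup>+y. F (x(j := y)) \<partial>lborel) p) \<partial>?M)
      \<le> epow (\<integral>\<^sup>+x. F x \<partial>?M) (1 + p)"
    using insert.IH[OF p _ F_meas] \<open>(s - 1) * p \<le> 1\<close> unfolding s_def by blast
  have upd2: "(\<lambda>x. \<integral>\<^sup>+z. f (x(j := z)) \<partial>lborel) \<in> borel_measurable ?M'" if "j \<in> insert i I" for j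
  proof -
    have "insert j (insert i I) = insert i I" using that by auto
    then have [measurable]: "(\<lambda>(x, y). x(j := y)) \<in> ?M' \<Otimes>\<^sub>M lborel \<rightarrow>\<^sub>M ?M'"
      using measurable_add_dim[of j "insert i I" "\<lambda>_. lborel :: real measure"] by simp
    show ?thesis by measurable
  qed
  have line: "(\<integral>\<^sup>+y. epow (f (x(i := y))) (1 - s * p) *
        (\<Prod>j\<in>insert i I. epow (\<integral>\<^sup>+z. f ((x(i := y))(j := z)) \<partial>lborel) p) \<partial>lborel)
      \<le> epow (F x) (1 - (s - 1) * p) * (\<Prod>j\<in>I. epow (\<integral>\<^sup>+y. F (x(j := y)) \<partial>lborel) p)"
    if x: "x \<in> space ?M" for x
  proof -
    have updx [measurable]: "(\<lambda>y. x(i := y)) \<in> lborel \<rightarrow>\<^sub>M ?M'"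
      using x by (intro measurable_fun_upd[where J=I]) auto
    define G where "G j y = (if j = i then f (x(i := y)) else \<integral>\<^sup>+z. f ((x(i := y))(j := z)) \<partial>lborel)" for j y
    define a where "a j = (if j = i then 1 - s * p else p)" for j
    have G_meas: "G j \<in> borel_measurable lborel" if "j \<in> insert i I" for j
      unfolding G_def using measurable_compose[OF updx upd2[OF that]] by measurable
    have GI: "(\<integral>\<^sup>+y. G j y \<partial>lborel) = (\<integral>\<^sup>+y. F (x(j := y)) \<partial>lborel)" if "j \<in> I" for j
    proof -
      have ij: "j \<noteq> i" using that insert.hyps by auto
      have 1: "I = I \<union> {j}" "insert i I = I \<union> {i}" using that by auto
      have [measurable]: "(\<lambda>(z, y). (x(j := z))(i := y)) \<in> lborel \<Otimes>\<^sub>M lborel \<rightarrow>\<^sub>M ?M'"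
        unfolding case_prod_beta using x
        by (intro measurable_fun_upd[OF 1(2)] measurable_fun_upd[OF 1(1)]) auto
      have "(\<integral>\<^sup>+y. G j y \<partial>lborel) = (\<integral>\<^sup>+y. \<integral>\<^sup>+z. f ((x(j := z))(i := y)) \<partial>lborel \<partial>lborel)"
        unfolding G_def using ij by (simp add: fun_upd_twist)
      also have "\<dots> = (\<integral>\<^sup>+z. \<integral>\<^sup>+y. f ((x(j := z))(i := y)) \<partial>lborel \<partial>lborel)"
        by (rule lborel_pair.Fubini') measurable
      finally show ?thesis
        by (simp add: F_def)
    qed
    have Gi: "(\<integral>\<^sup>+y. G i y \<partial>lborel) = F x"
      by (simp add: G_def F_def)
    have sum_a: "(\<Sum>j\<in>insert i I. a j) = 1"
    proof -
      have "(\<Sum>j\<in>I. a j) = (\<Sum>j\<in>I. p)"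
        using insert.hyps by (intro sum.cong) (auto simp: a_def)
      then show ?thesis
        using insert.hyps by (simp add: a_def s_def)
    qed
    have split: "(\<Prod>j\<in>insert i I. epow (g j) (a j)) = epow (g i) (1 - s * p) * (\<Prod>j\<in>I. epow (g j) p)" for g
    proof -
      have "(\<Prod>j\<in>I. epow (g j) (a j)) = (\<Prod>j\<in>I. epow (g j) p)"
        using insert.hyps by (intro prod.cong) (auto simp: a_def)
      then show ?thesis
        using insert.hyps by (simp add: a_def)
    qed
    have H: "(\<integral>\<^sup>+y. (\<Prod>j\<in>insert i I. epow (G j y) (a j)) \<partial>lborel) \<le> (\<Prod>j\<in>insert i I. epow (\<integral>\<^sup>+y. G j y \<partial>lborel) (a j))"
      using insert.hyps G_meas sum_a p sp by (intro Holder_nn_integral_prod) (auto simp: a_def)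
    have "(\<integral>\<^sup>+y. epow (f (x(i := y))) (1 - s * p) *
        (\<Prod>j\<in>insert i I. epow (\<integral>\<^sup>+z. f ((x(i := y))(j := z)) \<partial>lborel) p) \<partial>lborel)
      = (\<integral>\<^sup>+y. epow (F x) p * (\<Prod>j\<in>insert i I. epow (G j y) (a j)) \<partial>lborel)"
    proof (intro nn_integral_cong)
      fix y :: real
      have "(\<Prod>j\<in>I. epow (\<integral>\<^sup>+z. f ((x(i := y))(j := z)) \<partial>lborel) p) = (\<Prod>j\<in>I. epow (G j y) p)"
        using insert.hyps by (intro prod.cong) (auto simp: G_def)
      then show "epow (f (x(i := y))) (1 - s * p) *
          (\<Prod>j\<in>insert i I. epow (\<integral>\<^sup>+z. f ((x(i := y))(j := z)) \<partial>lborel) p)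
        = epow (F x) p * (\<Prod>j\<in>insert i I. epow (G j y) (a j))"
        unfolding split using insert.hyps by (simp add: F_def G_def ac_simps)
    qed
    also have "\<dots> = epow (F x) p * (\<integral>\<^sup>+y. (\<Prod>j\<in>insert i I. epow (G j y) (a j)) \<partial>lborel)"
      using G_meas by (intro nn_integral_cmult borel_measurable_prod_ennreal epow_measurable) auto
    also have "\<dots> \<le> epow (F x) p * (\<Prod>j\<in>insert i I. epow (\<integral>\<^sup>+y. G j y \<partial>lborel) (a j))"
      by (intro mult_left_mono H) auto
    also have "\<dots> = epow (F x) p * (epow (F x) (1 - s * p) * (\<Prod>j\<in>I. epow (\<integral>\<^sup>+y. F (x(j := y)) \<partial>lborel) p))"
      unfolding split by (simp add: GI Gi cong: prod.cong)
    also have "\<dots> = epow (F x) (p + (1 - s * p)) * (\<Prod>j\<in>I. epow (\<integral>\<^sup>+y. F (x(j := y)) \<partial>lborel) p)"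
      using p sp by (simp add: epow_add mult.assoc)
    also have "p + (1 - s * p) = 1 - (s - 1) * p"
      by (simp add: algebra_simps)
    finally show ?thesis .
  qed
  have meas: "(\<lambda>x. epow (f x) (1 - s * p) * (\<Prod>j\<in>insert i I. epow (\<integral>\<^sup>+z. f (x(j := z)) \<partial>lborel) p))
      \<in> borel_measurable ?M'"
    using upd2 by (intro borel_measurable_times_ennreal epow_measurable borel_measurable_prod_ennreal) auto
  have "(\<integral>\<^sup>+x. epow (f x) (1 - s * p) * (\<Prod>j\<in>insert i I. epow (\<integral>\<^sup>+z. f (x(j := z)) \<partial>lborel) p) \<partial>?M')
     = (\<integral>\<^sup>+x. \<integral>\<^sup>+y. epow (f (x(i := y))) (1 - s * p) *
        (\<Prod>j\<in>insert i I. epow (\<integral>\<^sup>+z. f ((x(i := y))(j := z)) \<partial>lborel) p) \<partial>lborel \<partial>?M)"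
    by (rule product_nn_integral_insert[OF insert.hyps(1,2) meas])
  also have "\<dots> \<le> (\<integral>\<^sup>+x. epow (F x) (1 - (s - 1) * p) * (\<Prod>j\<in>I. epow (\<integral>\<^sup>+y. F (x(j := y)) \<partial>lborel) p) \<partial>?M)"
    by (intro nn_integral_mono line)
  also have "\<dots> \<le> epow (\<integral>\<^sup>+x. F x \<partial>?M) (1 + p)"
    by (rule IH)
  also have "(\<integral>\<^sup>+x. F x \<partial>?M) = (\<integral>\<^sup>+x. f x \<partial>?M')"
    unfolding F_def by (rule product_nn_integral_insert[OF insert.hyps(1,2), symmetric]) measurable
  finally show ?case
    unfolding card .
qed

section \<open>The inequalities of Gagliardo-Nirenberg and Sobolev\<close>

text \<open>The function vanishes far to the left, so its value at \<open>t\<close> is the integral of its derivative up to \<open>t\<close>.\<close>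

lemma abs_le_nn_integral_deriv:
  fixes q q' :: "real \<Rightarrow> real"
  assumes der: "\<And>t. (q has_real_derivative q' t) (at t)"
    and cont: "continuous_on UNIV q'"
    and zero: "\<And>t. t < R \<Longrightarrow> q t = 0"
  shows "ennreal \<bar>q t\<bar> \<le> (\<integral>\<^sup>+s. ennreal \<bar>q' s\<bar> \<partial>lborel)"
proof -
  define a where "a = min t R - 1"
  have a: "a \<le> t" "q a = 0"
    using zero[of a] by (auto simp: a_def)
  have "has_bochner_integral lborel (\<lambda>s. q' s * indicator {a..t} s) (q t - q a)"
    using cont by (intro has_bochner_integral_FTC_Icc_real a der) (auto simp: continuous_on_eq_continuous_at)
  then have "ennreal (norm (q t - q a)) \<le> (\<integral>\<^sup>+s. ennreal (norm (q' s * indicator {a..t} s)) \<partial>lborel)"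
    by (rule has_bochner_integral_norm_bound)
  also have "\<dots> \<le> (\<integral>\<^sup>+s. ennreal \<bar>q' s\<bar> \<partial>lborel)"
    by (intro nn_integral_mono ennreal_leI) (auto simp: indicator_def)
  finally show ?thesis
    using a by simp
qed

lemma prod_mono_ennreal:
  fixes f g :: "'i \<Rightarrow> ennreal"
  assumes "\<And>i. i \<in> I \<Longrightarrow> f i \<le> g i"
  shows "prod f I \<le> prod g I"
  using assms by (induction I rule: infinite_finite_induct) (auto intro!: mult_mono)

text \<open>On every line through a point and parallel to a coordinate axis, \<open>\<bar>\<psi>\<bar>\<close> is bounded by the integral of
\<open>g\<close> along this line. The product of the \<open>n\<close> bounds, raised to the power \<open>1 / (n - 1)\<close>, is the integrand
of the grid-lines inequality with \<open>p = 1 / (n - 1)\<close>. For this \<open>p\<close> the exponent of \<open>g\<close> itself is zero.\<close>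

theorem gagliardo_nirenberg_L1:
  fixes \<psi> g :: "'a::euclidean_space \<Rightarrow> real" and D :: "'a \<Rightarrow> 'a \<Rightarrow> real"
  defines "n \<equiv> real DIM('a)"
  assumes dim: "2 \<le> DIM('a)"
    and der: "\<And>x. (\<psi> has_derivative D x) (at x)"
    and cont: "\<And>b. b \<in> Basis \<Longrightarrow> continuous_on UNIV (\<lambda>x. D x b)"
    and supp: "bounded {x. \<psi> x \<noteq> 0}"
    and bound: "\<And>x b. b \<in> Basis \<Longrightarrow> \<bar>D x b\<bar> \<le> g x"
    and g [measurable]: "g \<in> borel_measurable borel"
  shows "(\<integral>\<^sup>+x. epow (ennreal \<bar>\<psi> x\<bar>) (n / (n - 1)) \<partial>lborel) \<le> epow (\<integral>\<^sup>+x. ennreal (g x) \<partial>lborel) (n / (n - 1))"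
proof -
  define p where "p = 1 / (n - 1)"
  have n: "2 \<le> n" using dim by (simp add: n_def)
  have p: "0 < p" "(n - 1) * p = 1" "n / (n - 1) = n * p" "n / (n - 1) = 1 + p"
    using n by (auto simp: p_def field_simps)
  let ?M = "\<Pi>\<^sub>M b\<in>(Basis::'a set). (lborel :: real measure)"
  define X :: "('a \<Rightarrow> real) \<Rightarrow> 'a" where "X w = (\<Sum>b\<in>Basis. w b *\<^sub>R b)" for w
  have X_meas [measurable]: "X \<in> ?M \<rightarrow>\<^sub>M borel"
    unfolding X_def by measurable
  have X_upd: "X (w(b := t)) = X (w(b := 0)) + t *\<^sub>R b" if "b \<in> Basis" for w b t
  proof -
    have "(\<Sum>c\<in>Basis - {b}. (w(b := t)) c *\<^sub>R c) = (\<Sum>c\<in>Basis - {b}. (w(b := 0)) c *\<^sub>R c)"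
      by (intro sum.cong) auto
    then show ?thesis
      using that by (simp add: X_def sum.remove[of Basis b])
  qed
  have X_inner: "X w \<bullet> b = w b" if "b \<in> Basis" for w b
    using that by (simp add: X_def)
  obtain B where B: "\<And>x. \<psi> x \<noteq> 0 \<Longrightarrow> norm x \<le> B"
    using supp unfolding bounded_iff by auto
  have line: "ennreal \<bar>\<psi> (X w)\<bar> \<le> (\<integral>\<^sup>+y. ennreal (g (X (w(b := y)))) \<partial>lborel)" if b: "b \<in> Basis" for w b
  proof -
    define q where "q t = \<psi> (X (w(b := t)))" for t
    define q' where "q' t = D (X (w(b := t))) b" for t
    have "(q has_real_derivative q' t) (at t)" for t
    proof -
      have "((\<lambda>t. X (w(b := 0)) + t *\<^sub>R b) has_derivative (\<lambda>h. h *\<^sub>R b)) (at t)"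
        by (auto intro!: derivative_eq_intros)
      from has_derivative_compose[OF this der]
      have "((\<lambda>t. \<psi> (X (w(b := t)))) has_derivative (\<lambda>h. D (X (w(b := t))) (h *\<^sub>R b))) (at t)"
        by (simp add: X_upd[OF b, symmetric])
      moreover have "D x (h *\<^sub>R b) = D x b * h" for h x
        using linear_scale[OF has_derivative_linear[OF der[of x]], of h b] by simp
      ultimately show ?thesis
        unfolding q_def[abs_def] q'_def has_field_derivative_def by (simp add: mult_commute_abs)
    qed
    moreover have "continuous_on UNIV q'"
    proof -
      have "continuous_on UNIV (\<lambda>t. D (X (w(b := 0)) + t *\<^sub>R b) b)"
        by (rule continuous_on_compose2[OF cont[OF b]]) (auto intro!: continuous_intros)
      then show ?thesis
        unfolding q'_def[abs_def] by (simp add: X_upd[OF b, symmetric])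
    qed
    moreover have "q t = 0" if t: "t < - B" for t
    proof (rule ccontr)
      assume "q t \<noteq> 0"
      then have "norm (X (w(b := t))) \<le> B" unfolding q_def by (rule B)
      moreover have "\<bar>X (w(b := t)) \<bullet> b\<bar> \<le> norm (X (w(b := t)))"
        by (rule Basis_le_norm[OF b])
      ultimately show False
        using t X_inner[OF b, of "w(b := t)"] by simp
    qed
    ultimately have "ennreal \<bar>q (w b)\<bar> \<le> (\<integral>\<^sup>+s. ennreal \<bar>q' s\<bar> \<partial>lborel)"
      by (rule abs_le_nn_integral_deriv)
    also have "\<dots> \<le> (\<integral>\<^sup>+s. ennreal (g (X (w(b := s)))) \<partial>lborel)"
      unfolding q'_def by (intro nn_integral_mono ennreal_leI bound b)
    finally show ?thesis
      by (simp add: q_def)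
  qed
  have grid: "(\<integral>\<^sup>+w. (\<Prod>b\<in>Basis. epow (\<integral>\<^sup>+y. ennreal (g (X (w(b := y)))) \<partial>lborel) p) \<partial>?M)
      \<le> epow (\<integral>\<^sup>+w. ennreal (g (X w)) \<partial>?M) (1 + p)"
    using grid_lines_inequality[of "Basis :: 'a set" p "\<lambda>w. ennreal (g (X w))"] p
    by (simp add: n_def)
  have psi_cont: "continuous_on UNIV \<psi>"
    using der by (intro has_derivative_continuous_on) (auto intro: has_derivative_at_withinI)
  then have [measurable]: "\<psi> \<in> borel_measurable borel"
    by (rule borel_measurable_continuous_onI)
  have lb: "(lborel :: 'a measure) = distr ?M borel X"
    unfolding X_def by (rule lborel_eq)
  have "(\<integral>\<^sup>+x. epow (ennreal \<bar>\<psi> x\<bar>) (n / (n - 1)) \<partial>lborel) = (\<integral>\<^sup>+w. epow (ennreal \<bar>\<psi> (X w)\<bar>) (n / (n - 1)) \<partial>?M)"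
    by (subst lb, subst nn_integral_distr) measurable
  also have "\<dots> \<le> (\<integral>\<^sup>+w. (\<Prod>b\<in>Basis. epow (\<integral>\<^sup>+y. ennreal (g (X (w(b := y)))) \<partial>lborel) p) \<partial>?M)"
  proof (intro nn_integral_mono)
    fix w
    have "epow (ennreal \<bar>\<psi> (X w)\<bar>) (n * p) = epow (ennreal \<bar>\<psi> (X w)\<bar>) p ^ DIM('a)"
      using p(1) unfolding n_def by (intro epow_mult_nat) simp
    then have "epow (ennreal \<bar>\<psi> (X w)\<bar>) (n / (n - 1)) = (\<Prod>b\<in>(Basis::'a set). epow (ennreal \<bar>\<psi> (X w)\<bar>) p)"
      unfolding p(3) by simp
    also have "\<dots> \<le> (\<Prod>b\<in>Basis. epow (\<integral>\<^sup>+y. ennreal (g (X (w(b := y)))) \<partial>lborel) p)"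
      using p(1) line by (intro prod_mono_ennreal epow_mono) auto
    finally show "epow (ennreal \<bar>\<psi> (X w)\<bar>) (n / (n - 1)) \<le> \<dots>" .
  qed
  also have "\<dots> \<le> epow (\<integral>\<^sup>+w. ennreal (g (X w)) \<partial>?M) (1 + p)"
    by (rule grid)
  also have "(\<integral>\<^sup>+w. ennreal (g (X w)) \<partial>?M) = (\<integral>\<^sup>+x. ennreal (g x) \<partial>lborel)"
    by (subst lb, subst nn_integral_distr) measurable
  finally show ?thesis
    unfolding p(4) .
qed

text \<open>Up to a factor, this is the derivative of a power \<open>\<bar>s\<bar>\<close> to an exponent larger than one; its
continuity is what makes powers of \<open>C\<^sup>1\<close> functions again \<open>C\<^sup>1\<close>.\<close>

lemma continuous_on_abs_powr_sgn:
  assumes "0 < r"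
  shows "continuous_on UNIV (\<lambda>s::real. \<bar>s\<bar> powr r * sgn s)"
proof -
  have "(\<lambda>s::real. \<bar>s\<bar> powr r * sgn s) = (\<lambda>s. max s 0 powr r - max (- s) 0 powr r)"
    using assms by (auto simp: fun_eq_iff max_def sgn_if)
  then show ?thesis
    by (rule ssubst) (use assms in \<open>intro continuous_intros continuous_on_powr', auto\<close>)
qed

lemma abs_powr_has_real_derivative:
  fixes r s :: real
  assumes "1 < r"
  shows "((\<lambda>s. \<bar>s\<bar> powr r) has_real_derivative r * (\<bar>s\<bar> powr (r - 1) * sgn s)) (at s)"
proof -
  consider "0 < s" | "s < 0" | "s = 0" by linarith
  then show ?thesis
  proof cases
    case 1
    have "((\<lambda>s. s powr r) has_real_derivative r * s powr (r - 1)) (at s)"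
      using 1 by (rule has_real_derivative_powr)
    then have "((\<lambda>s. \<bar>s\<bar> powr r) has_real_derivative r * s powr (r - 1)) (at s)"
      by (rule has_field_derivative_transform_within_open[where S="{0<..}"]) (use 1 in auto)
    then show ?thesis using 1 by simp
  next
    case 2
    have "((\<lambda>s. (- s) powr r) has_real_derivative - (r * (- s) powr (r - 1))) (at s)"
      using 2 by (auto intro!: derivative_eq_intros)
    then have "((\<lambda>s. \<bar>s\<bar> powr r) has_real_derivative - (r * (- s) powr (r - 1))) (at s)"
      by (rule has_field_derivative_transform_within_open[where S="{..<0}"]) (use 2 in auto)
    then show ?thesis using 2 by simp
  next
    case 3
    have "((\<lambda>h::real. \<bar>h\<bar> powr (r - 1)) \<longlongrightarrow> 0) (at 0)"
      using assms by (auto intro!: tendsto_eq_intros tendsto_powr')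
    then have "((\<lambda>h::real. \<bar>h\<bar> powr r / h) \<longlongrightarrow> 0) (at 0)"
    proof (rule tendsto_rabs_zero_cancel[OF Lim_transform_eventually])
      show "\<forall>\<^sub>F h::real in at 0. \<bar>h\<bar> powr (r - 1) = \<bar>\<bar>h\<bar> powr r / h\<bar>"
        unfolding eventually_at_filter by (intro always_eventually) (auto simp: powr_diff)
    qed
    then show ?thesis
      using 3 assms by (simp add: DERIV_def)
  qed
qed

text \<open>The \<open>L\<^sup>1\<close> inequality is applied to \<open>\<bar>\<phi>\<bar>\<close> to the power \<open>\<gamma> = 2 (n - 1) / (n - 2)\<close>. This exponent makes both
the left-hand side and the square of the factor \<open>\<bar>\<phi>\<bar>\<^bsup>\<gamma> - 1\<^esup>\<close> of the gradient equal to the critical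
power of \<open>\<bar>\<phi>\<bar>\<close>, so that after Cauchy-Schwarz a part of it can be absorbed on the left.\<close>

theorem sobolev_inequality:
  fixes \<phi> G :: "'a::euclidean_space \<Rightarrow> real" and D :: "'a \<Rightarrow> 'a \<Rightarrow> real"
  defines "n \<equiv> real DIM('a)"
  assumes dim: "2 < DIM('a)"
    and der: "\<And>x. (\<phi> has_derivative D x) (at x)"
    and cont: "\<And>b. b \<in> Basis \<Longrightarrow> continuous_on UNIV (\<lambda>x. D x b)"
    and supp: "bounded {x. \<phi> x \<noteq> 0}"
    and bound: "\<And>x b. b \<in> Basis \<Longrightarrow> \<bar>D x b\<bar> \<le> G x"
    and G [measurable]: "G \<in> borel_measurable borel"
    and B: "(\<integral>\<^sup>+x. ennreal ((G x)\<^sup>2) \<partial>lborel) \<le> ennreal B" "0 \<le> B"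
  shows "(\<integral>\<^sup>+x. ennreal (\<bar>\<phi> x\<bar> powr (2 * n / (n - 2))) \<partial>lborel)
         \<le> ennreal (((2 * (n - 1) / (n - 2))\<^sup>2 * B) powr (n / (n - 2)))"
proof -
  define \<gamma> where "\<gamma> = 2 * (n - 1) / (n - 2)"
  have n: "2 < n" using dim by (simp add: n_def)
  have \<gamma>: "1 < \<gamma>" "\<gamma> - 1 = n / (n - 2)" "\<gamma> * (n / (n - 1)) = 2 * n / (n - 2)"
  proof -
    have "n - 1 \<noteq> 0" "n - 2 \<noteq> 0" using n by auto
    then show "\<gamma> * (n / (n - 1)) = 2 * n / (n - 2)"
      by (simp add: \<gamma>_def divide_simps) (simp add: algebra_simps)?
  qed (use n in \<open>auto simp: \<gamma>_def field_simps\<close>)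
  obtain b0 :: 'a where b0: "b0 \<in> Basis" by (rule SOME_Basis[THEN that])
  have G0: "0 \<le> G x" for x
    using bound[OF b0, of x] by linarith
  have phi_cont: "continuous_on UNIV \<phi>"
    using der by (intro has_derivative_continuous_on) (auto intro: has_derivative_at_withinI)
  then have [measurable]: "\<phi> \<in> borel_measurable borel"
    by (rule borel_measurable_continuous_onI)
  define A where "A = (\<integral>\<^sup>+x. ennreal (\<bar>\<phi> x\<bar> powr (2 * n / (n - 2))) \<partial>lborel)"
  \<comment> \<open>finiteness of \<open>A\<close> is what permits the cancellation of a power of it at the end\<close>
  have "A < top"
  proof -
    obtain R where R: "\<And>x. \<phi> x \<noteq> 0 \<Longrightarrow> norm x \<le> R"
      using supp unfolding bounded_iff by auto
    have "compact (\<phi> ` cball 0 R)"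
      using phi_cont by (intro compact_continuous_image) (auto intro: continuous_on_subset)
    then have "bounded (\<phi> ` cball 0 R)"
      by (rule compact_imp_bounded)
    then obtain C where "\<forall>y\<in>\<phi> ` cball 0 R. norm y \<le> C"
      unfolding bounded_iff by blast
    then have C: "\<bar>\<phi> x\<bar> \<le> C" if "x \<in> cball 0 R" for x
      using that by auto
    have "A \<le> (\<integral>\<^sup>+x. ennreal (C powr (2 * n / (n - 2))) * indicator (cball (0::'a) R) x \<partial>lborel)"
      unfolding A_def
    proof (intro nn_integral_mono)
      fix x
      show "ennreal (\<bar>\<phi> x\<bar> powr (2 * n / (n - 2))) \<le> ennreal (C powr (2 * n / (n - 2))) * indicator (cball 0 R) x"
        using n C[of x] R[of x] by (cases "x \<in> cball 0 R") (auto intro!: ennreal_leI powr_mono2)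
    qed
    also have "\<dots> = ennreal (C powr (2 * n / (n - 2))) * emeasure lborel (cball (0::'a) R)"
      by (subst nn_integral_cmult_indicator) auto
    also have "\<dots> < top"
      using emeasure_lborel_cball_finite[of "0::'a" R] by (simp add: ennreal_mult_less_top)
    finally show ?thesis .
  qed
  then obtain a where a: "A = ennreal a" "0 \<le> a"
    by (cases A) auto
  define g where "g x = \<gamma> * \<bar>\<phi> x\<bar> powr (\<gamma> - 1) * G x" for x
  have [measurable]: "g \<in> borel_measurable borel"
    unfolding g_def by measurable
  have CS: "(\<integral>\<^sup>+x. ennreal (g x) \<partial>lborel) \<le> ennreal (\<gamma> * sqrt (a * B))"
  proof -
    define T where "T = (\<integral>\<^sup>+x. ennreal (\<bar>\<phi> x\<bar> powr (\<gamma> - 1)) * ennreal (G x) \<partial>lborel)"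
    have "T\<^sup>2 \<le> (\<integral>\<^sup>+x. (ennreal (\<bar>\<phi> x\<bar> powr (\<gamma> - 1)))\<^sup>2 \<partial>lborel) * (\<integral>\<^sup>+x. (ennreal (G x))\<^sup>2 \<partial>lborel)"
      unfolding T_def by (rule Cauchy_Schwarz_nn_integral) measurable
    also have "(\<integral>\<^sup>+x. (ennreal (\<bar>\<phi> x\<bar> powr (\<gamma> - 1)))\<^sup>2 \<partial>lborel) = A"
      unfolding A_def
    proof (intro nn_integral_cong)
      fix x
      have "(\<bar>\<phi> x\<bar> powr (\<gamma> - 1))\<^sup>2 = \<bar>\<phi> x\<bar> powr ((\<gamma> - 1) + (\<gamma> - 1))"
        by (simp only: power2_eq_square powr_add)
      also have "(\<gamma> - 1) + (\<gamma> - 1) = 2 * n / (n - 2)"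
        by (simp add: \<gamma>(2))
      finally show "(ennreal (\<bar>\<phi> x\<bar> powr (\<gamma> - 1)))\<^sup>2 = ennreal (\<bar>\<phi> x\<bar> powr (2 * n / (n - 2)))"
        by (simp add: ennreal_power)
    qed
    also have "(\<integral>\<^sup>+x. (ennreal (G x))\<^sup>2 \<partial>lborel) = (\<integral>\<^sup>+x. ennreal ((G x)\<^sup>2) \<partial>lborel)"
      by (simp add: ennreal_power G0)
    finally have "T\<^sup>2 \<le> A * ennreal B"
      using B(1) by (meson mult_left_mono order_trans zero_le)
    also have "\<dots> = ennreal (a * B)"
      using a B by (simp add: ennreal_mult)
    finally have T2: "T\<^sup>2 \<le> ennreal (a * B)" .
    have "T \<le> ennreal (sqrt (a * B))"
    proof (cases T)
      case (real t)
      then have "t\<^sup>2 \<le> a * B"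
        using T2 a B by (simp add: ennreal_power)
      then show ?thesis
        using real by (auto intro!: ennreal_leI real_le_rsqrt)
    next
      case top
      then show ?thesis using T2 by (simp add: power2_eq_square ennreal_top_mult top_unique)
    qed
    moreover have "(\<integral>\<^sup>+x. ennreal (g x) \<partial>lborel) = ennreal \<gamma> * T"
      unfolding T_def g_def using \<gamma> G0
      by (subst nn_integral_cmult[symmetric]) (auto simp: ennreal_mult mult.assoc intro!: nn_integral_cong)
    ultimately show ?thesis
      using \<gamma> a B by (simp add: ennreal_mult mult_left_mono)
  qed
  have "(\<integral>\<^sup>+x. epow (ennreal \<bar>\<bar>\<phi> x\<bar> powr \<gamma>\<bar>) (n / (n - 1)) \<partial>lborel) \<le> epow (\<integral>\<^sup>+x. ennreal (g x) \<partial>lborel) (n / (n - 1))"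
    unfolding n_def
  proof (rule gagliardo_nirenberg_L1)
    show "2 \<le> DIM('a)" using dim by simp
    show "((\<lambda>x. \<bar>\<phi> x\<bar> powr \<gamma>) has_derivative (\<lambda>h. \<gamma> * (\<bar>\<phi> x\<bar> powr (\<gamma> - 1) * sgn (\<phi> x)) * D x h)) (at x)" for x
      using has_derivative_compose[OF der abs_powr_has_real_derivative[OF \<gamma>(1), unfolded has_field_derivative_def]]
      by (simp add: ac_simps)
    show "continuous_on UNIV (\<lambda>x. \<gamma> * (\<bar>\<phi> x\<bar> powr (\<gamma> - 1) * sgn (\<phi> x)) * D x b)" if "b \<in> Basis" for b
      using \<gamma> by (intro continuous_intros cont that continuous_on_compose2[OF continuous_on_abs_powr_sgn phi_cont]) auto
    show "bounded {x. \<bar>\<phi> x\<bar> powr \<gamma> \<noteq> 0}"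
      using supp by simp
    show "\<bar>\<gamma> * (\<bar>\<phi> x\<bar> powr (\<gamma> - 1) * sgn (\<phi> x)) * D x b\<bar> \<le> g x" if "b \<in> Basis" for x b
    proof -
      have "\<bar>\<gamma> * (\<bar>\<phi> x\<bar> powr (\<gamma> - 1) * sgn (\<phi> x)) * D x b\<bar> = \<gamma> * \<bar>\<phi> x\<bar> powr (\<gamma> - 1) * (\<bar>sgn (\<phi> x)\<bar> * \<bar>D x b\<bar>)"
        using \<gamma> by (simp add: abs_mult)
      also have "\<dots> \<le> \<gamma> * \<bar>\<phi> x\<bar> powr (\<gamma> - 1) * (1 * G x)"
        using \<gamma> bound[OF that, of x] by (intro mult_left_mono mult_mono) (auto simp: sgn_if)
      finally show ?thesis by (simp add: g_def)
    qed
  qed measurable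
  also have "\<dots> \<le> epow (ennreal (\<gamma> * sqrt (a * B))) (n / (n - 1))"
    using n by (intro epow_mono CS) auto
  also have "\<dots> = ennreal ((\<gamma> * sqrt (a * B)) powr (n / (n - 1)))"
    using n \<gamma> a B by (intro epow_ennreal) auto
  also have "(\<integral>\<^sup>+x. epow (ennreal \<bar>\<bar>\<phi> x\<bar> powr \<gamma>\<bar>) (n / (n - 1)) \<partial>lborel) = A"
    unfolding A_def using n by (intro nn_integral_cong) (simp add: epow_ennreal powr_powr \<gamma>(3)[simplified])
  finally have "a \<le> (\<gamma> * sqrt (a * B)) powr (n / (n - 1))"
    using a by simp
  have "a \<le> (\<gamma>\<^sup>2 * B) powr (n / (n - 2))"
  proof (cases "a = 0")
    case False
    then have apos: "0 < a" using a by simp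
    have "a powr ((n - 1) / n) \<le> ((\<gamma> * sqrt (a * B)) powr (n / (n - 1))) powr ((n - 1) / n)"
      using \<open>a \<le> (\<gamma> * sqrt (a * B)) powr (n / (n - 1))\<close> n a by (intro powr_mono2) auto
    also have "\<dots> = \<gamma> * sqrt (a * B)"
      using n \<gamma> a B by (simp add: powr_powr)
    finally have "(a powr ((n - 1) / n))\<^sup>2 \<le> (\<gamma> * sqrt (a * B))\<^sup>2"
      by (intro power_mono) auto
    then have "a powr (2 * (n - 1) / n) \<le> \<gamma>\<^sup>2 * B * a"
      using a B by (simp add: power_mult_distrib power2_eq_square[of "_ powr _"] powr_add[symmetric] ac_simps add_divide_distrib[symmetric])
    moreover have "a powr (2 * (n - 1) / n) = a powr ((n - 2) / n) * a"
    proof -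
      have "2 * (n - 1) / n = (n - 2) / n + 1" using n by (simp add: field_simps)
      then show ?thesis using apos by (simp add: powr_add)
    qed
    ultimately have "a powr ((n - 2) / n) \<le> \<gamma>\<^sup>2 * B"
      using apos by simp
    then have "(a powr ((n - 2) / n)) powr (n / (n - 2)) \<le> (\<gamma>\<^sup>2 * B) powr (n / (n - 2))"
      using n by (intro powr_mono2) auto
    then show ?thesis
      using n apos by (simp add: powr_powr)
  qed simp
  then show ?thesis
    using a unfolding A_def \<gamma>_def by (simp add: ennreal_leI)
qed

section \<open>Smooth truncations\<close>

text \<open>\<open>G\<close> is infinitely differentiable with first derivative \<open>G'\<close>; the sequence of all derivatives is the
witness, in the form that the chain rule for \<open>Ck\<close> consumes.\<close>

definition smooth_real :: "(real \<Rightarrow> real) \<Rightarrow> (real \<Rightarrow> real) \<Rightarrow> bool" where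
  "smooth_real G G' \<longleftrightarrow>
     (\<exists>D :: nat \<Rightarrow> real \<Rightarrow> real. D 0 = G \<and> D 1 = G' \<and> (\<forall>j s. (D j has_real_derivative D (Suc j) s) (at s)))"

lemma smooth_real_deriv: "smooth_real G G' \<Longrightarrow> (G has_real_derivative G' s) (at s)"
  unfolding smooth_real_def by (metis One_nat_def)

lemma smooth_real_continuous:
  assumes "smooth_real G G'"
  shows "continuous_on UNIV G" "continuous_on UNIV G'"
proof -
  obtain D where D: "D 0 = G" "D 1 = G'" "\<And>j s. (D j has_real_derivative D (Suc j) s) (at s)"
    using assms unfolding smooth_real_def by blast
  have "continuous_on UNIV (D j)" for j
    using D(3)[of j] by (auto intro!: continuous_at_imp_continuous_on DERIV_isCont)
  from this[of 0] this[of 1] show "continuous_on UNIV G" "continuous_on UNIV G'"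
    using D by auto
qed

lemma smooth_real_linear: "smooth_real (\<lambda>s. c * s) (\<lambda>_. c)"
  unfolding smooth_real_def
  by (rule exI[of _ "\<lambda>j s. if j = 0 then c * s else if j = 1 then c else 0"])
     (auto intro!: derivative_eq_intros)

lemma smooth_real_rescale:
  assumes "smooth_real G G'" "\<delta> \<noteq> 0"
  shows "smooth_real (\<lambda>s. \<delta> * G ((s - k) / \<delta>)) (\<lambda>s. G' ((s - k) / \<delta>))"
proof -
  obtain D where D: "D 0 = G" "D 1 = G'" "\<And>j s. (D j has_real_derivative D (Suc j) s) (at s)"
    using assms unfolding smooth_real_def by blast
  have aff: "((\<lambda>s. (s - k) / \<delta>) has_real_derivative 1 / \<delta>) (at s)" for s
    using assms(2) by (auto intro!: derivative_eq_intros)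
  show ?thesis
    unfolding smooth_real_def
  proof (intro exI[of _ "\<lambda>j s. \<delta> * (1 / \<delta>) ^ j * D j ((s - k) / \<delta>)"] conjI allI)
    fix j s
    show "((\<lambda>s. \<delta> * (1 / \<delta>) ^ j * D j ((s - k) / \<delta>)) has_real_derivative
        \<delta> * (1 / \<delta>) ^ Suc j * D (Suc j) ((s - k) / \<delta>)) (at s)"
      using DERIV_cmult[OF DERIV_chain2[OF D(3) aff], of "\<delta> * (1 / \<delta>) ^ j" j s] by (simp only: power_Suc ac_simps)
  qed (use D assms(2) in auto)
qed

text \<open>The standard example of smooth functions that vanish on a half-line, with a polynomial in \<open>1 / s\<close> as
a parameter: this family is closed under differentiation, which gives smoothness at once.\<close>

definition flat :: "real poly \<Rightarrow> real \<Rightarrow> real" where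
  "flat p s = (if s \<le> 0 then 0 else poly p (1 / s) * exp (- (1 / s)))"

lemma tendsto_flat_0: "(flat p \<longlongrightarrow> 0) (at 0)"
proof -
  \<comment> \<open>substitute \<open>x = 1 / s\<close>\<close>
  have "((\<lambda>x. \<Sum>i\<le>degree p. coeff p i * (x ^ i / exp x)) \<longlongrightarrow> (\<Sum>i\<le>degree p. coeff p i * 0)) at_top"
    by (intro tendsto_intros tendsto_power_div_exp_0)
  then have "((\<lambda>x. poly p x * exp (- x)) \<longlongrightarrow> 0) at_top"
    by (simp add: poly_altdef sum_distrib_right exp_minus divide_inverse mult.assoc)
  then have "((\<lambda>s. poly p (inverse s) * exp (- inverse s)) \<longlongrightarrow> 0) (at_right 0)"
    by (rule filterlim_compose[OF _ filterlim_inverse_at_top_right])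
  then have "(flat p \<longlongrightarrow> 0) (at_right 0)"
    by (rule Lim_transform_eventually) (auto simp: eventually_at_filter flat_def inverse_eq_divide)
  moreover have "(flat p \<longlongrightarrow> 0) (at_left 0)"
    by (rule Lim_transform_eventually[OF tendsto_const]) (auto simp: eventually_at_filter flat_def)
  ultimately show ?thesis
    by (simp add: filterlim_at_split)
qed

lemma flat_has_real_derivative:
  "(flat p has_real_derivative flat ([:0, 0, 1:] * (p - pderiv p)) s) (at s)"
proof -
  consider "0 < s" | "s < 0" | "s = 0" by linarith
  then show ?thesis
  proof cases
    case 1
    have "((\<lambda>s. poly p (1 / s) * exp (- (1 / s))) has_real_derivative flat ([:0, 0, 1:] * (p - pderiv p)) s) (at s)"
      using 1 by (auto intro!: derivative_eq_intros DERIV_chain2[OF poly_DERIV] simp: flat_def field_simps power2_eq_square)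
    then show ?thesis
      by (rule has_field_derivative_transform_within_open[where S="{0<..}"]) (use 1 in \<open>auto simp: flat_def\<close>)
  next
    case 2
    have "((\<lambda>s. 0) has_real_derivative flat ([:0, 0, 1:] * (p - pderiv p)) s) (at s)"
      using 2 by (simp add: flat_def)
    then show ?thesis
      by (rule has_field_derivative_transform_within_open[where S="{..<0}"]) (use 2 in \<open>auto simp: flat_def\<close>)
  next
    case 3
    have "((\<lambda>h. flat p h / h) \<longlongrightarrow> 0) (at 0)"
      by (rule Lim_transform_eventually[OF tendsto_flat_0[of "[:0, 1:] * p"]])
         (auto simp: eventually_at_filter flat_def)
    then show ?thesis
      using 3 by (simp add: DERIV_def flat_def)
  qed
qed

text \<open>A smooth replacement for the positive part of \<open>s\<close>. Its derivative is \<open>(1 + 1 / s) exp (- 1 / s)\<close>,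
the member of the flat family for the polynomial \<open>1 + X\<close>, and lies between \<open>0\<close> and \<open>1\<close>
because \<open>1 + t \<le> exp t\<close>.\<close>

definition ramp :: "real \<Rightarrow> real" where
  "ramp s = (if s \<le> 0 then 0 else s * exp (- (1 / s)))"

lemma smooth_real_ramp: "smooth_real ramp (flat [:1, 1:])"
proof -
  define P :: "nat \<Rightarrow> real poly" where "P j = ((\<lambda>p. [:0, 0, 1:] * (p - pderiv p)) ^^ j) [:1, 1:]" for j
  have der: "(ramp has_real_derivative flat [:1, 1:] s) (at s)" for s
  proof -
    consider "0 < s" | "s < 0" | "s = 0" by linarith
    then show ?thesis
    proof cases
      case 1
      have "((\<lambda>s. s * exp (- (1 / s))) has_real_derivative flat [:1, 1:] s) (at s)"
        using 1 by (auto intro!: derivative_eq_intros simp: flat_def field_simps power2_eq_square)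
      then show ?thesis
        by (rule has_field_derivative_transform_within_open[where S="{0<..}"]) (use 1 in \<open>auto simp: ramp_def\<close>)
    next
      case 2
      have "((\<lambda>s. 0) has_real_derivative flat [:1, 1:] s) (at s)"
        using 2 by (simp add: flat_def)
      then show ?thesis
        by (rule has_field_derivative_transform_within_open[where S="{..<0}"]) (use 2 in \<open>auto simp: ramp_def\<close>)
    next
      case 3
      have "((\<lambda>h. ramp h / h) \<longlongrightarrow> 0) (at 0)"
        by (rule Lim_transform_eventually[OF tendsto_flat_0[of 1]])
           (auto simp: eventually_at_filter flat_def ramp_def)
      then show ?thesis
        using 3 by (simp add: DERIV_def flat_def ramp_def)
    qed
  qed
  show ?thesis
    unfolding smooth_real_def
  proof (intro exI[of _ "\<lambda>j. case j of 0 \<Rightarrow> ramp | Suc j \<Rightarrow> flat (P j)"] conjI allI)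
    fix j s
    show "((case j of 0 \<Rightarrow> ramp | Suc j \<Rightarrow> flat (P j)) has_real_derivative
        (case Suc j of 0 \<Rightarrow> ramp | Suc j \<Rightarrow> flat (P j)) s) (at s)"
      using der flat_has_real_derivative by (cases j) (auto simp: P_def)
  qed (auto simp: P_def)
qed

lemma ramp_deriv_bounds: "0 \<le> flat [:1, 1:] s" "flat [:1, 1:] s \<le> 1"
proof -
  have "(1 + 1 / s) * exp (- (1 / s)) \<le> exp (1 / s) * exp (- (1 / s))"
    by (intro mult_right_mono) auto
  then show "flat [:1, 1:] s \<le> 1"
    by (simp add: flat_def exp_minus)
qed (simp add: flat_def)

text \<open>A smooth substitute for the truncation \<open>max (s - k) 0\<close>. The truncated solution enters the iteration
only through its vanishing below level \<open>k\<close>, the bound on its slope, and its size above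
level \<open>h\<close>; a fixed fraction of \<open>h - k\<close> is as good as \<open>h - k\<close> itself.\<close>

lemma smooth_truncation:
  fixes k h :: real
  assumes "0 \<le> k" "k < h"
  obtains T T' where "smooth_real T T'" "\<And>s. 0 \<le> T' s" "\<And>s. T' s \<le> 1"
    "\<And>s. s \<le> k \<Longrightarrow> T s = 0" "\<And>s. 0 \<le> T s" "\<And>s. h \<le> s \<Longrightarrow> (h - k) / exp 1 \<le> T s"
proof
  define \<delta> where "\<delta> = h - k"
  have \<delta>: "0 < \<delta>" using assms by (simp add: \<delta>_def)
  let ?T = "\<lambda>s. \<delta> * ramp ((s - k) / \<delta>)" and ?T' = "\<lambda>s. flat [:1, 1:] ((s - k) / \<delta>)"
  show "smooth_real ?T ?T'"
    using smooth_real_ramp \<delta> by (intro smooth_real_rescale) auto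
  show "0 \<le> ?T' s" "?T' s \<le> 1" for s
    by (rule ramp_deriv_bounds)+
  show "?T s = 0" if "s \<le> k" for s
    using that \<delta> by (simp add: ramp_def divide_le_0_iff)
  show "0 \<le> ?T s" for s
    using \<delta> by (auto simp: ramp_def divide_le_0_iff)
  show "(h - k) / exp 1 \<le> ?T s" if "h \<le> s" for s
  proof -
    have 1: "1 \<le> (s - k) / \<delta>" using that \<delta> by (simp add: \<delta>_def)
    have "1 * exp (- 1) \<le> (s - k) / \<delta> * exp (- (1 / ((s - k) / \<delta>)))"
      using 1 by (intro mult_mono) (auto simp: divide_simps split: if_splits)
    then show ?thesis
      using 1 \<delta> mult_left_mono[of "exp (- 1)" "ramp ((s - k) / \<delta>)" \<delta>]
      by (simp add: ramp_def \<delta>_def[symmetric] exp_minus divide_inverse)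
  qed
qed

section \<open>Composition and the Sobolev inequality for test functions\<close>

lemma partial_deriv_eq:
  assumes "(f has_derivative D) (at x)"
  shows "partial_deriv i f x = D (axis i 1)"
  unfolding partial_deriv_def using frechet_derivative_at[OF assms] by simp

lemma Ck_continuous: "Ck k f \<Longrightarrow> continuous_on UNIV f"
  by (cases k) (auto intro: differentiable_imp_continuous_on)

lemma Ck_differentiable: "Ck (Suc k) f \<Longrightarrow> (f has_derivative frechet_derivative f (at x)) (at x)"
  by (simp add: differentiable_on_def frechet_derivative_works[symmetric])

lemma Ck_SucD: "Ck (Suc k) f \<Longrightarrow> Ck k f"
  by (induction k arbitrary: f) (auto intro: differentiable_imp_continuous_on)

text \<open>The product rule of order \<open>k + 1\<close> needs both closure properties of order \<open>k\<close>, hence the joint induction.\<close>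

lemma Ck_mult: "Ck k f \<Longrightarrow> Ck k g \<Longrightarrow> Ck k (\<lambda>x. f x * g x)"
  and Ck_add: "Ck k f \<Longrightarrow> Ck k g \<Longrightarrow> Ck k (\<lambda>x. f x + g x)"
proof (induction k arbitrary: f g)
  case 0
  { case 1 then show ?case by (simp add: continuous_on_mult) next
    case 2 then show ?case by (simp add: continuous_on_add) }
next
  case (Suc k)
  { fix f g :: "real^'a \<Rightarrow> real"
    assume fg: "Ck (Suc k) f" "Ck (Suc k) g"
    have d: "(f has_derivative frechet_derivative f (at x)) (at x)"
      "(g has_derivative frechet_derivative g (at x)) (at x)" for x
      using fg Ck_differentiable by blast+
    have "partial_deriv i (\<lambda>x. f x * g x) = (\<lambda>x. f x * partial_deriv i g x + partial_deriv i f x * g x)"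
      "partial_deriv i (\<lambda>x. f x + g x) = (\<lambda>x. partial_deriv i f x + partial_deriv i g x)" for i
      unfolding partial_deriv_eq[OF has_derivative_mult[OF d], THEN ext]
        partial_deriv_eq[OF has_derivative_add[OF d], THEN ext] by (simp_all add: partial_deriv_def)
    note this fg Ck_SucD[OF fg(1)] Ck_SucD[OF fg(2)] }
  note * = this
  { case 1 then show ?case
      using *[OF 1] by (auto intro!: Suc.IH differentiable_on_mult) next
    case 2 then show ?case
      using *[OF 2] by (auto intro!: Suc.IH differentiable_on_add) }
qed

text \<open>The statement ranges over all derivatives \<open>D j\<close> because one differentiation of the composition moves
from \<open>D j\<close> to \<open>D (Suc j)\<close>.\<close>

lemma Ck_compose:
  assumes D: "\<And>j s. (D j has_real_derivative D (Suc j) s) (at s)" and f: "\<And>k. Ck k f"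
  shows "Ck k (\<lambda>x. D j (f x))"
proof (induction k arbitrary: j)
  case 0
  have "continuous_on UNIV (D j)"
    using D[of j] by (auto intro!: continuous_at_imp_continuous_on DERIV_isCont)
  then show ?case
    using Ck_continuous[OF f] by (auto intro: continuous_on_compose2)
next
  case (Suc k)
  have d: "((\<lambda>x. D j (f x)) has_derivative (\<lambda>h. D (Suc j) (f x) * frechet_derivative f (at x) h)) (at x)" for x
    using has_derivative_compose[OF Ck_differentiable[OF f] D[unfolded has_field_derivative_def]] .
  have "(\<lambda>x. D j (f x)) differentiable_on UNIV"
    using d unfolding differentiable_on_def differentiable_def by blast
  moreover have "partial_deriv i (\<lambda>x. D j (f x)) = (\<lambda>x. D (Suc j) (f x) * partial_deriv i f x)" for i
    using partial_deriv_eq[OF d] by (auto simp: partial_deriv_def)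
  moreover have "Ck k (partial_deriv i f)" for i
    using f[of "Suc k"] by simp
  ultimately show ?case
    using Suc.IH by (auto intro!: Ck_mult)
qed

lemma test_functionsD:
  assumes "\<phi> \<in> test_functions \<Omega>"
  shows "\<And>x. (\<phi> has_derivative frechet_derivative \<phi> (at x)) (at x)"
    and "continuous_on UNIV \<phi>" and "continuous_on UNIV (partial_deriv i \<phi>)" and "continuous_on UNIV (grad \<phi>)"
    and "x \<notin> \<Omega> \<Longrightarrow> \<phi> x = 0" and "x \<notin> closure {x. \<phi> x \<noteq> 0} \<Longrightarrow> grad \<phi> x = 0"
    and "x \<notin> \<Omega> \<Longrightarrow> grad \<phi> x = 0" and "compact (closure {x. \<phi> x \<noteq> 0})"
proof -
  have Ck: "\<And>k. Ck k \<phi>" and cl: "compact (closure {x. \<phi> x \<noteq> 0})" "closure {x. \<phi> x \<noteq> 0} \<subseteq> \<Omega>"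
    using assms by (auto simp: test_functions_def)
  show d: "(\<phi> has_derivative frechet_derivative \<phi> (at x)) (at x)" for x
    using Ck by (rule Ck_differentiable)
  show "continuous_on UNIV \<phi>"
    using Ck by (rule Ck_continuous)
  show c: "continuous_on UNIV (partial_deriv i \<phi>)" for i
    using Ck[of "Suc 0"] by simp
  show "continuous_on UNIV (grad \<phi>)"
    unfolding grad_def[abs_def] by (intro continuous_intros c)
  show "\<phi> x = 0" if "x \<notin> \<Omega>" for x
    using that cl(2) closure_subset[of "{x. \<phi> x \<noteq> 0}"] by auto
  show g0: "grad \<phi> x = 0" if "x \<notin> closure {x. \<phi> x \<noteq> 0}" for x
  proof -
    have "((\<lambda>x. 0) has_derivative (\<lambda>h. 0)) (at x)" by simp
    then have "(\<phi> has_derivative (\<lambda>h. 0)) (at x)"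
    proof (rule has_derivative_transform_within_open)
      show "open (- closure {x. \<phi> x \<noteq> 0})" by auto
      show "0 = \<phi> y" if "y \<in> - closure {x. \<phi> x \<noteq> 0}" for y
        using that closure_subset[of "{x. \<phi> x \<noteq> 0}"] by auto
    qed (use that in auto)
    then show ?thesis
      by (simp add: grad_def partial_deriv_eq vec_eq_iff)
  qed
  show "grad \<phi> x = 0" if "x \<notin> \<Omega>" for x
    using that cl(2) by (intro g0) blast
  show "compact (closure {x. \<phi> x \<noteq> 0})" by fact
qed

text \<open>The condition \<open>G 0 = 0\<close> keeps the support inside that of \<open>\<phi>\<close>.\<close>

lemma test_functions_compose:
  assumes \<phi>: "\<phi> \<in> test_functions \<Omega>" and G: "smooth_real G G'" "G 0 = 0"
  shows "(\<lambda>x. G (\<phi> x)) \<in> test_functions \<Omega>"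
    and "grad (\<lambda>x. G (\<phi> x)) x = G' (\<phi> x) *\<^sub>R grad \<phi> x"
proof -
  obtain D where D: "D 0 = G" "\<And>j s. (D j has_real_derivative D (Suc j) s) (at s)"
    using G unfolding smooth_real_def by blast
  have "Ck k (\<lambda>x. G (\<phi> x))" for k
    using Ck_compose[of D \<phi> k 0] \<phi> D by (simp add: test_functions_def)
  moreover have "closure {x. G (\<phi> x) \<noteq> 0} \<subseteq> closure {x. \<phi> x \<noteq> 0}"
    using G by (intro closure_mono) auto
  ultimately show "(\<lambda>x. G (\<phi> x)) \<in> test_functions \<Omega>"
    using \<phi> bounded_subset[of "closure {x. \<phi> x \<noteq> 0}" "closure {x. G (\<phi> x) \<noteq> 0}"]
    by (auto simp: test_functions_def compact_eq_bounded_closed)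
  have "((\<lambda>x. G (\<phi> x)) has_derivative (\<lambda>h. G' (\<phi> x) * frechet_derivative \<phi> (at x) h)) (at x)"
    using has_derivative_compose[OF test_functionsD(1)[OF \<phi>] smooth_real_deriv[OF G(1), unfolded has_field_derivative_def]] .
  then show "grad (\<lambda>x. G (\<phi> x)) x = G' (\<phi> x) *\<^sub>R grad \<phi> x"
    by (simp add: grad_def partial_deriv_eq vec_eq_iff) (simp add: partial_deriv_def)
qed

lemma nn_integral_lebesgue_on:
  fixes f :: "'a::euclidean_space \<Rightarrow> ennreal"
  assumes "open \<Omega>" "\<And>x. x \<notin> \<Omega> \<Longrightarrow> f x = 0"
  shows "(\<integral>\<^sup>+x. f x \<partial>lebesgue_on \<Omega>) = (\<integral>\<^sup>+x. f x \<partial>lborel)"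
proof -
  have "(\<integral>\<^sup>+x. f x \<partial>lebesgue_on \<Omega>) = (\<integral>\<^sup>+x. f x * indicator \<Omega> x \<partial>lebesgue)"
    using assms(1) by (intro nn_integral_restrict_space) auto
  also have "(\<lambda>x. f x * indicator \<Omega> x) = f"
    using assms(2) by (auto simp: indicator_def fun_eq_iff)
  finally show ?thesis
    by (simp add: nn_integral_completion)
qed

lemma continuous_imp_measurable_lebesgue_on:
  fixes f :: "'a::euclidean_space \<Rightarrow> 'b::topological_space"
  assumes "continuous_on UNIV f"
  shows "f \<in> borel_measurable (lebesgue_on S)"
  using assms by (intro measurable_restrict_space1 measurable_completion) (simp add: borel_measurable_continuous_onI)

lemma sobolev_test_functions:
  fixes \<Omega> :: "(real^'n) set"
  defines "N \<equiv> real CARD('n)"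
  assumes dim: "2 < CARD('n)" and \<Omega>: "open \<Omega>" and \<phi>: "\<phi> \<in> test_functions \<Omega>"
    and B: "(\<integral>\<^sup>+x. ennreal ((norm (grad \<phi> x))\<^sup>2) \<partial>lebesgue_on \<Omega>) \<le> ennreal B" "0 \<le> B"
  shows "(\<integral>\<^sup>+x. ennreal (\<bar>\<phi> x\<bar> powr (2 * N / (N - 2))) \<partial>lebesgue_on \<Omega>)
    \<le> ennreal (((2 * (N - 1) / (N - 2))\<^sup>2 * B) powr (N / (N - 2)))"
proof -
  have basis: "\<exists>i. b = axis i 1" if "b \<in> Basis" for b :: "real^'n"
    using that by (auto simp: Basis_vec_def)
  have pd: "frechet_derivative \<phi> (at x) (axis i 1) = grad \<phi> x $ i" for x i
    by (simp add: grad_def partial_deriv_def)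
  have "(\<integral>\<^sup>+x. ennreal (\<bar>\<phi> x\<bar> powr (2 * real DIM(real^'n) / (real DIM(real^'n) - 2))) \<partial>lborel)
    \<le> ennreal (((2 * (real DIM(real^'n) - 1) / (real DIM(real^'n) - 2))\<^sup>2 * B) powr (real DIM(real^'n) / (real DIM(real^'n) - 2)))"
  proof (rule sobolev_inequality)
    show "(\<phi> has_derivative frechet_derivative \<phi> (at x)) (at x)" for x
      by (rule test_functionsD(1)[OF \<phi>])
    show "continuous_on UNIV (\<lambda>x. frechet_derivative \<phi> (at x) b)" if "b \<in> Basis" for b
      using basis[OF that] test_functionsD(3)[OF \<phi>] by (auto simp: partial_deriv_def[abs_def])
    show "bounded {x. \<phi> x \<noteq> 0}"
      using test_functionsD(8)[OF \<phi>] by (meson bounded_subset closure_subset compact_imp_bounded)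
    show "\<bar>frechet_derivative \<phi> (at x) b\<bar> \<le> norm (grad \<phi> x)" if "b \<in> Basis" for x b
      using basis[OF that] component_le_norm_cart[of "grad \<phi> x"] by (auto simp: pd)
    show "(\<lambda>x. norm (grad \<phi> x)) \<in> borel_measurable borel"
      using test_functionsD(4)[OF \<phi>] by (intro borel_measurable_continuous_onI continuous_intros)
    show "(\<integral>\<^sup>+x. ennreal ((norm (grad \<phi> x))\<^sup>2) \<partial>lborel) \<le> ennreal B"
      using B(1) test_functionsD(7)[OF \<phi>] by (subst (asm) nn_integral_lebesgue_on[OF \<Omega>]) auto
  qed (use dim B in auto)
  then show ?thesis
    using test_functionsD(5)[OF \<phi>] by (subst nn_integral_lebesgue_on[OF \<Omega>]) (auto simp: N_def)
qed

section \<open>Energy estimates for nonlinear functions of a weak solution\<close>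

lemma Cauchy_Schwarz_integral:
  fixes f h :: "'a \<Rightarrow> real"
  assumes [measurable]: "f \<in> borel_measurable M" "h \<in> borel_measurable M"
    and int: "integrable M (\<lambda>x. (f x)\<^sup>2)" "integrable M (\<lambda>x. (h x)\<^sup>2)"
  shows "integrable M (\<lambda>x. f x * h x)"
    and "(\<integral>x. \<bar>f x * h x\<bar> \<partial>M) \<le> sqrt (\<integral>x. (f x)\<^sup>2 \<partial>M) * sqrt (\<integral>x. (h x)\<^sup>2 \<partial>M)"
proof -
  show i: "integrable M (\<lambda>x. f x * h x)"
  proof (rule Bochner_Integration.integrable_bound[OF Bochner_Integration.integrable_add[OF int]])
    have "\<bar>f x * h x\<bar> \<le> (f x)\<^sup>2 + (h x)\<^sup>2" for x
    proof -
      have "2 * (\<bar>f x\<bar> * \<bar>h x\<bar>) \<le> (f x)\<^sup>2 + (h x)\<^sup>2"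
        using sum_squares_bound[of "\<bar>f x\<bar>" "\<bar>h x\<bar>"] by simp
      moreover have "0 \<le> \<bar>f x\<bar> * \<bar>h x\<bar>" by simp
      ultimately show ?thesis unfolding abs_mult by linarith
    qed
    then show "AE x in M. norm (f x * h x) \<le> norm ((f x)\<^sup>2 + (h x)\<^sup>2)"
      by (intro AE_I2) simp
  qed measurable
  have "ennreal ((\<integral>x. \<bar>f x * h x\<bar> \<partial>M)\<^sup>2) = (\<integral>\<^sup>+x. ennreal \<bar>f x\<bar> * ennreal \<bar>h x\<bar> \<partial>M)\<^sup>2"
    using nn_integral_eq_integral[OF integrable_abs[OF i]]
    by (simp add: ennreal_power abs_mult ennreal_mult integral_nonneg_AE)
  also have "\<dots> \<le> (\<integral>\<^sup>+x. (ennreal \<bar>f x\<bar>)\<^sup>2 \<partial>M) * (\<integral>\<^sup>+x. (ennreal \<bar>h x\<bar>)\<^sup>2 \<partial>M)"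
    by (rule Cauchy_Schwarz_nn_integral) measurable
  also have "\<dots> = ennreal (\<integral>x. (f x)\<^sup>2 \<partial>M) * ennreal (\<integral>x. (h x)\<^sup>2 \<partial>M)"
    using nn_integral_eq_integral[OF int(1)] nn_integral_eq_integral[OF int(2)] by (simp add: ennreal_power)
  also have "\<dots> = ennreal ((\<integral>x. (f x)\<^sup>2 \<partial>M) * (\<integral>x. (h x)\<^sup>2 \<partial>M))"
    by (simp add: ennreal_mult)
  finally have "(\<integral>x. \<bar>f x * h x\<bar> \<partial>M)\<^sup>2 \<le> (\<integral>x. (f x)\<^sup>2 \<partial>M) * (\<integral>x. (h x)\<^sup>2 \<partial>M)"
    by (subst (asm) ennreal_le_iff) auto
  then show "(\<integral>x. \<bar>f x * h x\<bar> \<partial>M) \<le> sqrt (\<integral>x. (f x)\<^sup>2 \<partial>M) * sqrt (\<integral>x. (h x)\<^sup>2 \<partial>M)"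
    unfolding real_sqrt_mult[symmetric] by (rule real_le_rsqrt)
qed

lemma norm_diff_square_le:
  fixes a b :: "'a::real_normed_vector"
  shows "(norm (a - b))\<^sup>2 \<le> 2 * (norm a)\<^sup>2 + 2 * (norm b)\<^sup>2"
proof -
  have "(norm (a - b))\<^sup>2 \<le> (norm a + norm b)\<^sup>2"
    by (intro power_mono norm_triangle_ineq4) auto
  also have "\<dots> \<le> 2 * (norm a)\<^sup>2 + 2 * (norm b)\<^sup>2"
    using sum_squares_bound[of "norm a" "norm b"] by (simp add: power2_sum)
  finally show ?thesis .
qed

text \<open>A weak solution of \<open>-\<Delta>u = g\<close> with zero boundary values and \<open>V\<close> in the role of its gradient. Keeping \<open>V\<close>
as a parameter, instead of the chosen weak gradient of \<open>u\<close>, makes the assumptions stable under the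
passage from \<open>u\<close> to \<open>-u\<close>.\<close>

locale weak_poisson =
  fixes \<Omega> :: "(real^'n) set" and u g :: "real^'n \<Rightarrow> real" and V :: "real^'n \<Rightarrow> real^'n" and K :: real
  assumes dim: "2 < CARD('n)" and open_dom: "open \<Omega>" and bounded_dom: "bounded \<Omega>"
    and u_L2: "square_integrable \<Omega> u" and V_L2: "square_integrable \<Omega> V"
    and approx: "\<exists>\<phi>. (\<forall>k::nat. \<phi> k \<in> test_functions \<Omega>) \<and>
       (\<lambda>k. \<integral>x. (u x - \<phi> k x)\<^sup>2 \<partial>lebesgue_on \<Omega>) \<longlonglongrightarrow> 0 \<and>
       (\<lambda>k. \<integral>x. (norm (V x - grad (\<phi> k) x))\<^sup>2 \<partial>lebesgue_on \<Omega>) \<longlonglongrightarrow> 0"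
    and g_meas: "g \<in> borel_measurable (lebesgue_on \<Omega>)"
    and g_bound: "AE x in lebesgue_on \<Omega>. \<bar>g x\<bar> \<le> K" and K_nonneg: "0 \<le> K"
    and weak_eq: "\<And>\<phi>. \<phi> \<in> test_functions \<Omega> \<Longrightarrow>
       (\<integral>x. V x \<bullet> grad \<phi> x \<partial>lebesgue_on \<Omega>) = (\<integral>x. g x * \<phi> x \<partial>lebesgue_on \<Omega>)"
begin

abbreviation "M \<equiv> lebesgue_on \<Omega>"

definition "N = real CARD('n)"
definition "q = crit_exp N"
text \<open>The constant of the Sobolev inequality for squared norms.\<close>

definition "S = (2 * (N - 1) / (N - 2))\<^sup>2"

lemma N_gt_2: "2 < N"
  using dim by (simp add: N_def)

lemma q_eq: "q = 2 * N / (N - 2)" "q / 2 = N / (N - 2)" "2 < q"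
  using N_gt_2 by (auto simp: q_def crit_exp_def field_simps)

lemma S_pos: "0 < S"
  using N_gt_2 by (simp add: S_def)

sublocale finite_measure M
  using open_dom bounded_dom by (intro finite_measure_lebesgue_on bounded_set_imp_lmeasurable) auto

lemma M_measurable [measurable]:
  "u \<in> borel_measurable M" "V \<in> borel_measurable M" "g \<in> borel_measurable M"
  using u_L2 V_L2 g_meas by (auto simp: square_integrable_def)

lemma int_square: "integrable M (\<lambda>x. (u x)\<^sup>2)" "integrable M (\<lambda>x. (norm (V x))\<^sup>2)"
  using u_L2 V_L2 by (auto simp: square_integrable_def)

lemma test_meas:
  assumes "\<phi> \<in> test_functions \<Omega>"
  shows "\<phi> \<in> borel_measurable M" "grad \<phi> \<in> borel_measurable M"
  using test_functionsD(2,4)[OF assms] by (auto intro: continuous_imp_measurable_lebesgue_on)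

lemma continuous_comp_meas:
  assumes "continuous_on UNIV (c :: real \<Rightarrow> real)" "v \<in> borel_measurable M"
  shows "(\<lambda>x. c (v x)) \<in> borel_measurable M"
  using borel_measurable_continuous_onI[OF assms(1)] assms(2) by (rule measurable_compose_rev)

lemma test_int_square:
  assumes \<phi>: "\<phi> \<in> test_functions \<Omega>"
  shows "integrable M (\<lambda>x. (\<phi> x)\<^sup>2)" "integrable M (\<lambda>x. (norm (grad \<phi> x))\<^sup>2)"
proof -
  note [measurable] = test_meas[OF \<phi>]
  let ?C = "closure {x. \<phi> x \<noteq> 0}"
  have bnd: "integrable M h" if h: "continuous_on UNIV h" "\<And>x. x \<notin> ?C \<Longrightarrow> h x = 0" for h :: "_ \<Rightarrow> real"
  proof -
    have "bounded (h ` ?C)"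
      using h(1) test_functionsD(8)[OF \<phi>]
      by (intro compact_imp_bounded compact_continuous_image) (auto intro: continuous_on_subset)
    then obtain B where B: "\<forall>y\<in>h ` ?C. norm y \<le> B"
      unfolding bounded_iff by blast
    have "norm (h x) \<le> \<bar>B\<bar>" for x
      using B h(2)[of x] by (cases "x \<in> ?C") force+
    then show ?thesis
      by (intro integrable_const_bound[of _ "\<bar>B\<bar>"] continuous_imp_measurable_lebesgue_on h(1)) auto
  qed
  show "integrable M (\<lambda>x. (\<phi> x)\<^sup>2)"
  proof (rule bnd)
    show "(\<phi> x)\<^sup>2 = 0" if "x \<notin> ?C" for x
      using that closure_subset[of "{x. \<phi> x \<noteq> 0}"] by auto
  qed (intro continuous_intros test_functionsD(2)[OF \<phi>])
  show "integrable M (\<lambda>x. (norm (grad \<phi> x))\<^sup>2)"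
    using test_functionsD(4,6)[OF \<phi>] by (intro bnd continuous_intros) auto
qed

lemma test_int_diff_square:
  assumes \<phi>: "\<phi> \<in> test_functions \<Omega>"
  shows "integrable M (\<lambda>x. (u x - \<phi> x)\<^sup>2)" "integrable M (\<lambda>x. (norm (V x - grad \<phi> x))\<^sup>2)"
proof -
  note [measurable] = test_meas[OF \<phi>]
  have "integrable M (\<lambda>x. 2 * (u x)\<^sup>2 + 2 * (\<phi> x)\<^sup>2)"
    using int_square(1) test_int_square(1)[OF \<phi>] by auto
  then show "integrable M (\<lambda>x. (u x - \<phi> x)\<^sup>2)"
    by (rule Bochner_Integration.integrable_bound)
       (use norm_diff_square_le[of "u x" "\<phi> x" for x] in \<open>auto intro!: AE_I2\<close>)
  have "integrable M (\<lambda>x. 2 * (norm (V x))\<^sup>2 + 2 * (norm (grad \<phi> x))\<^sup>2)"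
    using int_square(2) test_int_square(2)[OF \<phi>] by auto
  then show "integrable M (\<lambda>x. (norm (V x - grad \<phi> x))\<^sup>2)"
    by (rule Bochner_Integration.integrable_bound)
       (use norm_diff_square_le[of "V x" "grad \<phi> x" for x] in \<open>auto intro!: AE_I2\<close>)
qed

text \<open>Convergence in \<open>L\<^sup>2\<close> gives convergence almost everywhere along a subsequence; this is needed to pass to
the limit in nonlinear expressions of the approximating test functions.\<close>

lemma approximants:
  obtains \<phi> where "\<And>k::nat. \<phi> k \<in> test_functions \<Omega>"
    "(\<lambda>k. \<integral>x. (u x - \<phi> k x)\<^sup>2 \<partial>M) \<longlonglongrightarrow> 0"
    "(\<lambda>k. \<integral>x. (norm (V x - grad (\<phi> k) x))\<^sup>2 \<partial>M) \<longlonglongrightarrow> 0"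
    "AE x in M. (\<lambda>k. \<phi> k x) \<longlonglongrightarrow> u x"
proof -
  obtain \<phi> where \<phi>: "\<And>k::nat. \<phi> k \<in> test_functions \<Omega>"
    "(\<lambda>k. \<integral>x. (u x - \<phi> k x)\<^sup>2 \<partial>M) \<longlonglongrightarrow> 0"
    "(\<lambda>k. \<integral>x. (norm (V x - grad (\<phi> k) x))\<^sup>2 \<partial>M) \<longlonglongrightarrow> 0"
    using approx by blast
  have "\<exists>r::nat\<Rightarrow>nat. strict_mono r \<and> (AE x in M. (\<lambda>k. (u x - \<phi> (r k) x)\<^sup>2) \<longlonglongrightarrow> 0)"
    using tendsto_L1_AE_subseq[of M "\<lambda>k x. (u x - \<phi> k x)\<^sup>2"] test_int_diff_square(1)[OF \<phi>(1)] \<phi>(2) by auto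
  then obtain r :: "nat \<Rightarrow> nat" where r: "strict_mono r" and ae: "AE x in M. (\<lambda>k. (u x - \<phi> (r k) x)\<^sup>2) \<longlonglongrightarrow> 0"
    by blast
  show ?thesis
  proof (rule that[of "\<lambda>k. \<phi> (r k)"])
    show "AE x in M. (\<lambda>k. \<phi> (r k) x) \<longlonglongrightarrow> u x"
      using ae
    proof eventually_elim
      case (elim x)
      have "(\<lambda>k. sqrt ((u x - \<phi> (r k) x)\<^sup>2)) \<longlonglongrightarrow> sqrt 0"
        by (intro tendsto_intros elim)
      then have "(\<lambda>k. \<bar>\<phi> (r k) x - u x\<bar>) \<longlonglongrightarrow> 0"
        by (simp add: abs_minus_commute)
      then show ?case
        by (rule LIM_zero_cancel[OF tendsto_rabs_zero_cancel])
    qed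
  qed (use \<phi>(1) LIMSEQ_subseq_LIMSEQ[OF \<phi>(2) r] LIMSEQ_subseq_LIMSEQ[OF \<phi>(3) r] in \<open>auto simp: o_def\<close>)
qed

context
  fixes G G' :: "real \<Rightarrow> real"
  assumes G: "smooth_real G G'" and G0: "G 0 = 0" and G'1: "\<And>s. \<bar>G' s\<bar> \<le> 1"
begin

lemma G_lipschitz: "\<bar>G s - G t\<bar> \<le> \<bar>s - t\<bar>"
proof -
  have *: "\<bar>G b - G a\<bar> \<le> b - a" if "a < b" for a b
  proof -
    have "\<exists>z>a. z < b \<and> G b - G a = (b - a) * G' z"
      using that smooth_real_deriv[OF G] by (rule MVT2)
    then obtain z where "G b - G a = (b - a) * G' z"
      by auto
    then show ?thesis
      using that G'1[of z] by (simp add: abs_mult mult_left_le)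
  qed
  from *[of s t] *[of t s] show ?thesis
    by (cases s t rule: linorder_cases) auto
qed

lemma G_measurable [measurable]:
  "v \<in> borel_measurable M \<Longrightarrow> (\<lambda>x. G (v x)) \<in> borel_measurable M"
  "v \<in> borel_measurable M \<Longrightarrow> (\<lambda>x. G' (v x)) \<in> borel_measurable M"
  by (rule continuous_comp_meas[OF smooth_real_continuous(1)[OF G]],
      assumption, rule continuous_comp_meas[OF smooth_real_continuous(2)[OF G]])

lemma int_G: "integrable M (\<lambda>x. G (u x))" "integrable M (\<lambda>x. g x * G (u x))"
proof -
  have "integrable M u"
    using Cauchy_Schwarz_integral(1)[of u M "\<lambda>_. 1"] int_square(1) by simp
  then show i: "integrable M (\<lambda>x. G (u x))"
    by (rule Bochner_Integration.integrable_bound)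
       (use G_lipschitz[of "u x" 0 for x] G0 in \<open>auto intro!: AE_I2\<close>)
  show "integrable M (\<lambda>x. g x * G (u x))"
  proof (rule Bochner_Integration.integrable_bound)
    show "integrable M (\<lambda>x. K * G (u x))"
      using i by simp
    show "AE x in M. norm (g x * G (u x)) \<le> norm (K * G (u x))"
      using g_bound by eventually_elim (use K_nonneg in \<open>auto simp: abs_mult intro!: mult_right_mono\<close>)
  qed measurable
qed

text \<open>Formally, the identity is the equation tested with \<open>G(u)\<close>, whose gradient is \<open>G'(u) V\<close>, and the
inequality is Sobolev for \<open>G(u)\<close>. Equation and inequality are available for the test functions \<open>G(\<phi>\<^sub>k)\<close>,
where \<open>\<phi>\<^sub>k\<close> approximates \<open>u\<close>. In the limit, differences of gradients are controlled by strong \<open>L\<^sup>2\<close> convergence, the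
coefficients \<open>G'(\<phi>\<^sub>k)\<close> in front of \<open>\<bar>V\<bar>\<^sup>2\<close> by dominated convergence, the term with \<open>g\<close> by the Lipschitz bound,
and the critical norm by Fatou's lemma.\<close>

lemma energy:
  shows energy_identity: "(\<integral>x. G' (u x) * (norm (V x))\<^sup>2 \<partial>M) = (\<integral>x. g x * G (u x) \<partial>M)"
    and energy_sobolev: "(\<integral>\<^sup>+x. ennreal (\<bar>G (u x)\<bar> powr q) \<partial>M)
      \<le> ennreal ((S * (\<integral>x. (G' (u x))\<^sup>2 * (norm (V x))\<^sup>2 \<partial>M)) powr (q / 2))"
proof -
  obtain \<phi> where \<phi>: "\<And>k::nat. \<phi> k \<in> test_functions \<Omega>"
    and u_lim: "(\<lambda>k. \<integral>x. (u x - \<phi> k x)\<^sup>2 \<partial>M) \<longlonglongrightarrow> 0"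
    and V_lim: "(\<lambda>k. \<integral>x. (norm (V x - grad (\<phi> k) x))\<^sup>2 \<partial>M) \<longlonglongrightarrow> 0"
    and ae: "AE x in M. (\<lambda>k. \<phi> k x) \<longlonglongrightarrow> u x"
    by (rule approximants) blast
  note [measurable] = test_meas[OF \<phi>]
  note G_cont = smooth_real_continuous[OF G]
  have G_test: "(\<lambda>x. G (\<phi> k x)) \<in> test_functions \<Omega>"
    and G_grad: "grad (\<lambda>x. G (\<phi> k x)) x = G' (\<phi> k x) *\<^sub>R grad (\<phi> k) x" for k x
    using test_functions_compose[OF \<phi> G G0] by auto
  have weight_lim: "(\<lambda>k. \<integral>x. c (\<phi> k x) * (norm (V x))\<^sup>2 \<partial>M) \<longlonglongrightarrow> (\<integral>x. c (u x) * (norm (V x))\<^sup>2 \<partial>M)"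
    and weight_int: "\<And>k. integrable M (\<lambda>x. c (\<phi> k x) * (norm (V x))\<^sup>2)"
    if c: "continuous_on UNIV c" "\<And>s. \<bar>c s\<bar> \<le> 1" for c :: "real \<Rightarrow> real"
  proof -
    have [measurable]: "(\<lambda>x. c (v x)) \<in> borel_measurable M" if "v \<in> borel_measurable M" for v
      using c(1) that by (rule continuous_comp_meas)
    have le: "norm (c s * (norm (V x))\<^sup>2) \<le> (norm (V x))\<^sup>2" for s x
      using mult_right_mono[OF c(2)[of s], of "(norm (V x))\<^sup>2"] by (simp add: abs_mult)
    show "(\<lambda>k. \<integral>x. c (\<phi> k x) * (norm (V x))\<^sup>2 \<partial>M) \<longlonglongrightarrow> (\<integral>x. c (u x) * (norm (V x))\<^sup>2 \<partial>M)"
    proof (rule integral_dominated_convergence[where w="\<lambda>x. (norm (V x))\<^sup>2"])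
      show "AE x in M. (\<lambda>k. c (\<phi> k x) * (norm (V x))\<^sup>2) \<longlonglongrightarrow> c (u x) * (norm (V x))\<^sup>2"
        using ae
      proof eventually_elim
        case (elim x)
        have "isCont c (u x)"
          using c(1) by (simp add: continuous_on_eq_continuous_at)
        then show ?case
          by (intro tendsto_intros isCont_tendsto_compose[OF _ elim])
      qed
    qed (use le int_square(2) in auto)
    show "integrable M (\<lambda>x. c (\<phi> k x) * (norm (V x))\<^sup>2)" for k
      using int_square(2) by (rule Bochner_Integration.integrable_bound) (use le in \<open>auto intro!: AE_I2\<close>)
  qed
  \<comment> \<open>the error made when one of the two gradient factors is replaced by its limit\<close>
  define r where "r k x = norm (V x - grad (\<phi> k) x) * norm (V x)" for k x
  have [measurable]: "r k \<in> borel_measurable M" for k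
    unfolding r_def by measurable
  have r_int: "integrable M (r k)"
    and r_le: "(\<integral>x. \<bar>r k x\<bar> \<partial>M) \<le> sqrt (\<integral>x. (norm (V x - grad (\<phi> k) x))\<^sup>2 \<partial>M) * sqrt (\<integral>x. (norm (V x))\<^sup>2 \<partial>M)" for k
    unfolding r_def using test_int_diff_square(2)[OF \<phi>] int_square(2)
    by (intro Cauchy_Schwarz_integral; measurable)+
  have r_lim: "(\<lambda>k. \<integral>x. r k x \<partial>M) \<longlonglongrightarrow> 0"
  proof (rule Lim_null_comparison)
    show "\<forall>\<^sub>F k in sequentially. norm (\<integral>x. r k x \<partial>M)
        \<le> sqrt (\<integral>x. (norm (V x - grad (\<phi> k) x))\<^sup>2 \<partial>M) * sqrt (\<integral>x. (norm (V x))\<^sup>2 \<partial>M)"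
      using r_le by (intro always_eventually allI) (simp add: r_def)
    show "(\<lambda>k. sqrt (\<integral>x. (norm (V x - grad (\<phi> k) x))\<^sup>2 \<partial>M) * sqrt (\<integral>x. (norm (V x))\<^sup>2 \<partial>M)) \<longlonglongrightarrow> 0"
      using tendsto_mult_left_zero[OF tendsto_real_sqrt[OF V_lim, simplified]] .
  qed

  show "(\<integral>x. G' (u x) * (norm (V x))\<^sup>2 \<partial>M) = (\<integral>x. g x * G (u x) \<partial>M)"
  proof (rule LIMSEQ_unique)
    define a where "a k = (\<integral>x. V x \<bullet> (G' (\<phi> k x) *\<^sub>R grad (\<phi> k) x) \<partial>M)" for k
    have a_eq: "a k = (\<integral>x. g x * G (\<phi> k x) \<partial>M)" for k
      using weak_eq[OF G_test, of k] by (simp add: a_def G_grad)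
    have int_a: "integrable M (\<lambda>x. V x \<bullet> (G' (\<phi> k x) *\<^sub>R grad (\<phi> k) x))" for k
    proof (rule Bochner_Integration.integrable_bound)
      show "integrable M (\<lambda>x. norm (V x) * norm (grad (\<phi> k) x))"
        using test_int_square(2)[OF \<phi>] int_square(2) by (intro Cauchy_Schwarz_integral) auto
      show "AE x in M. norm (V x \<bullet> (G' (\<phi> k x) *\<^sub>R grad (\<phi> k) x)) \<le> norm (norm (V x) * norm (grad (\<phi> k) x))"
      proof (rule AE_I2)
        fix x
        have "norm (V x \<bullet> (G' (\<phi> k x) *\<^sub>R grad (\<phi> k) x)) = \<bar>G' (\<phi> k x)\<bar> * \<bar>V x \<bullet> grad (\<phi> k) x\<bar>"
          by (simp add: abs_mult)
        also have "\<dots> \<le> 1 * (norm (V x) * norm (grad (\<phi> k) x))"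
          by (intro mult_mono G'1 Cauchy_Schwarz_ineq2) auto
        finally show "norm (V x \<bullet> (G' (\<phi> k x) *\<^sub>R grad (\<phi> k) x)) \<le> norm (norm (V x) * norm (grad (\<phi> k) x))"
          by simp
      qed
    qed measurable
    have "(\<lambda>k. a k - (\<integral>x. G' (\<phi> k x) * (norm (V x))\<^sup>2 \<partial>M)) \<longlonglongrightarrow> 0"
    proof (rule Lim_null_comparison[OF _ r_lim], intro always_eventually allI)
      fix k
      have "a k - (\<integral>x. G' (\<phi> k x) * (norm (V x))\<^sup>2 \<partial>M)
          = (\<integral>x. V x \<bullet> (G' (\<phi> k x) *\<^sub>R grad (\<phi> k) x) - G' (\<phi> k x) * (norm (V x))\<^sup>2 \<partial>M)"
        unfolding a_def by (intro Bochner_Integration.integral_diff[symmetric] int_a weight_int G_cont(2) G'1)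
      also have "norm \<dots> \<le> (\<integral>x. r k x \<partial>M)"
      proof (rule Bochner_Integration.integral_norm_bound_integral)
        fix x
        have "V x \<bullet> (G' (\<phi> k x) *\<^sub>R grad (\<phi> k) x) - G' (\<phi> k x) * (norm (V x))\<^sup>2
            = G' (\<phi> k x) * ((grad (\<phi> k) x - V x) \<bullet> V x)"
          by (simp add: power2_norm_eq_inner inner_diff_left inner_diff_right right_diff_distrib inner_commute)
        also have "norm \<dots> \<le> 1 * (norm (grad (\<phi> k) x - V x) * norm (V x))"
          unfolding real_norm_def abs_mult by (intro mult_mono G'1 Cauchy_Schwarz_ineq2) auto
        finally show "norm (V x \<bullet> (G' (\<phi> k x) *\<^sub>R grad (\<phi> k) x) - G' (\<phi> k x) * (norm (V x))\<^sup>2) \<le> r k x"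
          by (simp add: r_def norm_minus_commute)
      qed (intro Bochner_Integration.integrable_diff int_a weight_int G_cont(2) G'1 r_int)+
      finally show "norm (a k - (\<integral>x. G' (\<phi> k x) * (norm (V x))\<^sup>2 \<partial>M)) \<le> (\<integral>x. r k x \<partial>M)" .
    qed
    from tendsto_add[OF this weight_lim[OF G_cont(2) G'1]]
    show "a \<longlonglongrightarrow> (\<integral>x. G' (u x) * (norm (V x))\<^sup>2 \<partial>M)"
      by simp
    have int_b: "integrable M (\<lambda>x. g x * G (\<phi> k x))" for k
    proof (rule Bochner_Integration.integrable_bound)
      show "integrable M (\<lambda>x. K * \<phi> k x)"
        using Cauchy_Schwarz_integral(1)[of "\<phi> k" M "\<lambda>_. 1"] test_int_square(1)[OF \<phi>, of k] by simp
      show "AE x in M. norm (g x * G (\<phi> k x)) \<le> norm (K * \<phi> k x)"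
        using g_bound
        by eventually_elim
           (use K_nonneg G_lipschitz[of "\<phi> k x" 0 for x] G0 in \<open>auto simp: abs_mult intro!: mult_mono\<close>)
    qed measurable
    have "(\<lambda>k. a k - (\<integral>x. g x * G (u x) \<partial>M)) \<longlonglongrightarrow> 0"
    proof (rule Lim_null_comparison, intro always_eventually allI)
      fix k
      have int_d: "integrable M (\<lambda>x. K * \<bar>(u x - \<phi> k x) * 1\<bar>)"
        using Cauchy_Schwarz_integral(1)[of "\<lambda>x. u x - \<phi> k x" M "\<lambda>_. 1"] test_int_diff_square(1)[OF \<phi>, of k] by simp
      have "a k - (\<integral>x. g x * G (u x) \<partial>M) = (\<integral>x. g x * G (\<phi> k x) - g x * G (u x) \<partial>M)"
        unfolding a_eq using int_b int_G(2) by simp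
      also have "norm \<dots> \<le> (\<integral>x. \<bar>g x * G (\<phi> k x) - g x * G (u x)\<bar> \<partial>M)"
        using integral_norm_bound[of M "\<lambda>x. g x * G (\<phi> k x) - g x * G (u x)"] by simp
      also have "\<dots> \<le> (\<integral>x. K * \<bar>(u x - \<phi> k x) * 1\<bar> \<partial>M)"
      proof (rule integral_mono_AE)
        show "AE x in M. \<bar>g x * G (\<phi> k x) - g x * G (u x)\<bar> \<le> K * \<bar>(u x - \<phi> k x) * 1\<bar>"
          using g_bound
        proof eventually_elim
          case (elim x)
          then have "\<bar>g x\<bar> * \<bar>G (\<phi> k x) - G (u x)\<bar> \<le> K * \<bar>\<phi> k x - u x\<bar>"
            using K_nonneg by (intro mult_mono G_lipschitz) auto
          then show ?case
            by (simp add: abs_mult[symmetric] right_diff_distrib abs_minus_commute)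
        qed
      qed (use int_b int_G(2) int_d in auto)
      also have "\<dots> = K * (\<integral>x. \<bar>(u x - \<phi> k x) * 1\<bar> \<partial>M)"
        by simp
      also have "\<dots> \<le> K * (sqrt (\<integral>x. (u x - \<phi> k x)\<^sup>2 \<partial>M) * sqrt (\<integral>x. 1\<^sup>2 \<partial>M))"
        using test_int_diff_square(1)[OF \<phi>, of k] K_nonneg
        by (intro mult_left_mono Cauchy_Schwarz_integral) auto
      finally show "norm (a k - (\<integral>x. g x * G (u x) \<partial>M))
          \<le> K * (sqrt (\<integral>x. (u x - \<phi> k x)\<^sup>2 \<partial>M) * sqrt (\<integral>x. 1\<^sup>2 \<partial>M))" .
    next
      show "(\<lambda>k. K * (sqrt (\<integral>x. (u x - \<phi> k x)\<^sup>2 \<partial>M) * sqrt (\<integral>x. 1\<^sup>2 \<partial>M))) \<longlonglongrightarrow> 0"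
        using tendsto_mult_right_zero[OF tendsto_mult_left_zero[OF tendsto_real_sqrt[OF u_lim, simplified]]] .
    qed
    then show "a \<longlonglongrightarrow> (\<integral>x. g x * G (u x) \<partial>M)"
      by (rule LIM_zero_cancel)
  qed

  define c where "c s = (G' s)\<^sup>2" for s
  have c: "continuous_on UNIV c" "\<And>s. \<bar>c s\<bar> \<le> 1" "\<And>s. 0 \<le> c s"
    unfolding c_def using G_cont(2) G'1 by (auto intro!: continuous_intros simp: abs_square_le_1)
  have [measurable]: "(\<lambda>x. c (v x)) \<in> borel_measurable M" if "v \<in> borel_measurable M" for v
    using c(1) that by (rule continuous_comp_meas)
  define B where "B k = (\<integral>x. c (\<phi> k x) * (norm (grad (\<phi> k) x))\<^sup>2 \<partial>M)" for k
  have int_B: "integrable M (\<lambda>x. c (\<phi> k x) * (norm (grad (\<phi> k) x))\<^sup>2)" for k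
    using test_int_square(2)[OF \<phi>, of k]
  proof (rule Bochner_Integration.integrable_bound)
    show "AE x in M. norm (c (\<phi> k x) * (norm (grad (\<phi> k) x))\<^sup>2) \<le> norm ((norm (grad (\<phi> k) x))\<^sup>2)"
      using mult_right_mono[OF c(2)] by (intro AE_I2) (simp add: abs_mult)
  qed measurable
  have B_nonneg: "0 \<le> B k" for k
    unfolding B_def using c(3) by (intro integral_nonneg_AE AE_I2) auto
  have B_lim: "B \<longlonglongrightarrow> (\<integral>x. c (u x) * (norm (V x))\<^sup>2 \<partial>M)"
  proof -
    have "(\<lambda>k. B k - (\<integral>x. c (\<phi> k x) * (norm (V x))\<^sup>2 \<partial>M)) \<longlonglongrightarrow> 0"
    proof (rule Lim_null_comparison, intro always_eventually allI)
      fix k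
      have "B k - (\<integral>x. c (\<phi> k x) * (norm (V x))\<^sup>2 \<partial>M)
          = (\<integral>x. c (\<phi> k x) * (norm (grad (\<phi> k) x))\<^sup>2 - c (\<phi> k x) * (norm (V x))\<^sup>2 \<partial>M)"
        unfolding B_def by (intro Bochner_Integration.integral_diff[symmetric] int_B weight_int c)
      also have "norm \<dots> \<le> (\<integral>x. (norm (V x - grad (\<phi> k) x))\<^sup>2 + 2 * r k x \<partial>M)"
      proof (rule Bochner_Integration.integral_norm_bound_integral)
        fix x
        have "(norm (grad (\<phi> k) x))\<^sup>2 - (norm (V x))\<^sup>2
            = (norm (V x - grad (\<phi> k) x))\<^sup>2 + 2 * ((grad (\<phi> k) x - V x) \<bullet> V x)"
          by (simp add: power2_norm_eq_inner inner_diff_left inner_diff_right inner_commute)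
        moreover have "\<bar>(grad (\<phi> k) x - V x) \<bullet> V x\<bar> \<le> r k x"
          using Cauchy_Schwarz_ineq2[of "grad (\<phi> k) x - V x" "V x"] by (simp add: r_def norm_minus_commute)
        moreover have "0 \<le> (norm (V x - grad (\<phi> k) x))\<^sup>2" by simp
        ultimately have "\<bar>(norm (grad (\<phi> k) x))\<^sup>2 - (norm (V x))\<^sup>2\<bar> \<le> (norm (V x - grad (\<phi> k) x))\<^sup>2 + 2 * r k x"
          by linarith
        then have "\<bar>c (\<phi> k x)\<bar> * \<bar>(norm (grad (\<phi> k) x))\<^sup>2 - (norm (V x))\<^sup>2\<bar>
            \<le> 1 * ((norm (V x - grad (\<phi> k) x))\<^sup>2 + 2 * r k x)"
          by (intro mult_mono c(2)) auto
        then show "norm (c (\<phi> k x) * (norm (grad (\<phi> k) x))\<^sup>2 - c (\<phi> k x) * (norm (V x))\<^sup>2)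
            \<le> (norm (V x - grad (\<phi> k) x))\<^sup>2 + 2 * r k x"
          by (simp add: abs_mult[symmetric] right_diff_distrib)
      qed (intro Bochner_Integration.integrable_diff Bochner_Integration.integrable_add integrable_mult_right
          int_B weight_int c r_int test_int_diff_square(2)[OF \<phi>])+
      also have "\<dots> = (\<integral>x. (norm (V x - grad (\<phi> k) x))\<^sup>2 \<partial>M) + 2 * (\<integral>x. r k x \<partial>M)"
        using r_int test_int_diff_square(2)[OF \<phi>] by simp
      finally show "norm (B k - (\<integral>x. c (\<phi> k x) * (norm (V x))\<^sup>2 \<partial>M))
          \<le> (\<integral>x. (norm (V x - grad (\<phi> k) x))\<^sup>2 \<partial>M) + 2 * (\<integral>x. r k x \<partial>M)" .
    next
      show "(\<lambda>k. (\<integral>x. (norm (V x - grad (\<phi> k) x))\<^sup>2 \<partial>M) + 2 * (\<integral>x. r k x \<partial>M)) \<longlonglongrightarrow> 0"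
        using V_lim r_lim by (auto intro!: tendsto_eq_intros)
    qed
    from tendsto_add[OF this weight_lim[OF c(1,2)]] show ?thesis
      by simp
  qed
  have sob: "(\<integral>\<^sup>+x. ennreal (\<bar>G (\<phi> k x)\<bar> powr q) \<partial>M) \<le> ennreal ((S * B k) powr (q / 2))" for k
    unfolding q_eq(2) unfolding q_eq(1) S_def N_def
  proof (rule sobolev_test_functions[OF dim open_dom G_test _ B_nonneg])
    have "(\<integral>\<^sup>+x. ennreal ((norm (grad (\<lambda>x. G (\<phi> k x)) x))\<^sup>2) \<partial>M)
        = (\<integral>\<^sup>+x. ennreal (c (\<phi> k x) * (norm (grad (\<phi> k) x))\<^sup>2) \<partial>M)"
      unfolding G_grad c_def by (simp add: power_mult_distrib)
    also have "\<dots> = ennreal (B k)"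
      unfolding B_def using int_B c(3) by (intro nn_integral_eq_integral) auto
    finally show "(\<integral>\<^sup>+x. ennreal ((norm (grad (\<lambda>x. G (\<phi> k x)) x))\<^sup>2) \<partial>M) \<le> ennreal (B k)"
      by simp
  qed
  have "(\<integral>\<^sup>+x. ennreal (\<bar>G (u x)\<bar> powr q) \<partial>M) \<le> (\<integral>\<^sup>+x. liminf (\<lambda>k. ennreal (\<bar>G (\<phi> k x)\<bar> powr q)) \<partial>M)"
  proof (rule nn_integral_mono_AE)
    show "AE x in M. ennreal (\<bar>G (u x)\<bar> powr q) \<le> liminf (\<lambda>k. ennreal (\<bar>G (\<phi> k x)\<bar> powr q))"
      using ae
    proof eventually_elim
      case (elim x)
      have "isCont G (u x)"
        using G_cont(1) by (simp add: continuous_on_eq_continuous_at)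
      then have "(\<lambda>k. G (\<phi> k x)) \<longlonglongrightarrow> G (u x)"
        by (rule isCont_tendsto_compose[OF _ elim])
      then have "(\<lambda>k. ennreal (\<bar>G (\<phi> k x)\<bar> powr q)) \<longlonglongrightarrow> ennreal (\<bar>G (u x)\<bar> powr q)"
        using q_eq(3) by (intro tendsto_ennrealI tendsto_powr' tendsto_rabs tendsto_const) auto
      from lim_imp_Liminf[OF trivial_limit_sequentially this] show ?case
        by simp
    qed
  qed
  also have "\<dots> \<le> liminf (\<lambda>k. \<integral>\<^sup>+x. ennreal (\<bar>G (\<phi> k x)\<bar> powr q) \<partial>M)"
    by (rule nn_integral_liminf) measurable
  also have "\<dots> \<le> liminf (\<lambda>k. ennreal ((S * B k) powr (q / 2)))"
    by (rule Liminf_mono[OF always_eventually]) (rule allI, rule sob)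
  also have "\<dots> = ennreal ((S * (\<integral>x. c (u x) * (norm (V x))\<^sup>2 \<partial>M)) powr (q / 2))"
  proof (rule lim_imp_Liminf)
    show "(\<lambda>k. ennreal ((S * B k) powr (q / 2))) \<longlonglongrightarrow> ennreal ((S * (\<integral>x. c (u x) * (norm (V x))\<^sup>2 \<partial>M)) powr (q / 2))"
    proof (rule tendsto_ennrealI, rule tendsto_powr')
      show "(\<lambda>k. S * B k) \<longlonglongrightarrow> S * (\<integral>x. c (u x) * (norm (V x))\<^sup>2 \<partial>M)"
        by (rule tendsto_mult_left[OF B_lim])
      have "0 \<le> S * B k" for k
        using S_pos B_nonneg[of k] by simp
      then show "S * (\<integral>x. c (u x) * (norm (V x))\<^sup>2 \<partial>M) \<noteq> 0 \<or> 0 < q / 2 \<and> (\<forall>\<^sub>F k in sequentially. 0 \<le> S * B k)"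
        using q_eq(3) by simp
    qed (rule tendsto_const)
  qed simp
  finally show "(\<integral>\<^sup>+x. ennreal (\<bar>G (u x)\<bar> powr q) \<partial>M)
      \<le> ennreal ((S * (\<integral>x. (G' (u x))\<^sup>2 * (norm (V x))\<^sup>2 \<partial>M)) powr (q / 2))"
    by (simp add: c_def)
qed

end

end

section \<open>The bound for the supremum by truncation\<close>

lemma Holder_integral:
  fixes f h :: "'a \<Rightarrow> real"
  assumes [measurable]: "f \<in> borel_measurable M" "h \<in> borel_measurable M"
    and p: "0 < p" "0 < p'" "1 / p + 1 / p' = 1"
    and int: "integrable M (\<lambda>x. \<bar>f x\<bar> powr p)" "integrable M (\<lambda>x. \<bar>h x\<bar> powr p')"
  shows "(\<integral>x. \<bar>f x * h x\<bar> \<partial>M) \<le> (\<integral>x. \<bar>f x\<bar> powr p \<partial>M) powr (1 / p) * (\<integral>x. \<bar>h x\<bar> powr p' \<partial>M) powr (1 / p')"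
proof (rule integral_real_bounded)
  define F where "F b x = (if b then ennreal (\<bar>f x\<bar> powr p) else ennreal (\<bar>h x\<bar> powr p'))" for b x
  define a where "a b = (if b then 1 / p else 1 / p')" for b
  have "(\<integral>\<^sup>+x. (\<Prod>b\<in>UNIV. epow (F b x) (a b)) \<partial>M) \<le> (\<Prod>b\<in>UNIV. epow (\<integral>\<^sup>+x. F b x \<partial>M) (a b))"
    using p unfolding F_def a_def by (intro Holder_nn_integral_prod) (auto simp: UNIV_bool)
  moreover have "(\<Prod>b\<in>UNIV. epow (F b x) (a b)) = ennreal \<bar>f x * h x\<bar>" for x
    using p by (simp add: UNIV_bool F_def a_def epow_ennreal powr_powr ennreal_mult[symmetric] abs_mult mult.commute)
  moreover have "(\<integral>\<^sup>+x. F True x \<partial>M) = ennreal (\<integral>x. \<bar>f x\<bar> powr p \<partial>M)" "(\<integral>\<^sup>+x. F False x \<partial>M) = ennreal (\<integral>x. \<bar>h x\<bar> powr p' \<partial>M)"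
    unfolding F_def using nn_integral_eq_integral[OF int(1)] nn_integral_eq_integral[OF int(2)] by auto
  ultimately show "(\<integral>\<^sup>+x. ennreal \<bar>f x * h x\<bar> \<partial>M)
      \<le> ennreal ((\<integral>x. \<bar>f x\<bar> powr p \<partial>M) powr (1 / p) * (\<integral>x. \<bar>h x\<bar> powr p' \<partial>M) powr (1 / p'))"
    using p by (simp add: UNIV_bool a_def epow_ennreal ennreal_mult mult.commute)
qed simp

text \<open>With \<open>A powr (1 / q)\<close> in the role of the critical norm of a solution, the equation bounds the energy linearly
in this norm, and Sobolev bounds the square of the norm by the energy. One factor cancels.\<close>

lemma powr_self_improvement:
  fixes A c q :: real
  assumes "0 \<le> A" "0 \<le> c" "0 < q" and le: "A \<le> (c * A powr (1 / q)) powr (q / 2)"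
  shows "A powr (1 / q) \<le> c"
proof (cases "A = 0")
  case False
  then have A: "0 < A" using assms by simp
  have "A powr (2 / q) \<le> ((c * A powr (1 / q)) powr (q / 2)) powr (2 / q)"
    using assms by (intro powr_mono2) auto
  also have "\<dots> = c * A powr (1 / q)"
    using assms by (simp add: powr_powr)
  also have "A powr (2 / q) = A powr (1 / q) * A powr (1 / q)"
    by (simp add: powr_add[symmetric])
  finally show ?thesis
    using A by simp
qed (use assms in simp)

text \<open>Because \<open>r > 1\<close>, the step inequality gains more from the smallness of \<open>m s\<close> than it loses by taking
\<open>t - s\<close> small. Along the levels \<open>k + d (1 - 2 powr (-n))\<close> the values of \<open>m\<close> decay geometrically, with rate
\<open>2 powr (-\<mu>)\<close>; the exponent \<open>\<mu> = q / (r - 1)\<close> is the one that the step reproduces, and the lower bound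
on \<open>d\<close> is exactly what its constant requires.\<close>

lemma stampacchia_iteration:
  fixes m :: "real \<Rightarrow> real" and c d k q r :: real
  assumes m_nonneg: "\<And>t. 0 \<le> m t" and m_anti: "\<And>s t. s \<le> t \<Longrightarrow> m t \<le> m s"
    and step: "\<And>s t. k \<le> s \<Longrightarrow> s < t \<Longrightarrow> m t \<le> (c / (t - s)) powr q * m s powr r"
    and "0 \<le> c" "0 < q" "1 < r" "0 < d"
    and d: "c * m k powr ((r - 1) / q) * 2 powr (r / (r - 1)) \<le> d"
  shows "m (k + d) = 0"
proof (cases "m k = 0")
  case True
  then show ?thesis
    using m_nonneg[of "k + d"] m_anti[of k "k + d"] \<open>0 < d\<close> by simp
next
  case False
  then have mk: "0 < m k" using m_nonneg[of k] by simp
  define \<mu> where "\<mu> = q / (r - 1)"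
  have \<mu>: "0 < \<mu>" "\<mu> * (r - 1) = q" using assms by (auto simp: \<mu>_def)
  define lev where "lev n = k + d * (1 - 2 powr (- real n))" for n :: nat
  have small: "(c / d) powr q * m k powr (r - 1) \<le> 2 powr (- (q + \<mu>))"
  proof -
    have "c / d * m k powr ((r - 1) / q) * 2 powr (r / (r - 1)) \<le> 1"
      using d \<open>0 < d\<close> by (simp add: field_simps)
    then have "(c / d * m k powr ((r - 1) / q) * 2 powr (r / (r - 1))) powr q \<le> 1 powr q"
      using assms by (intro powr_mono2) auto
    have "r / (r - 1) * q = q + \<mu>"
      using \<open>1 < r\<close> by (simp add: \<mu>_def field_simps)
    have "(c / d) powr q * m k powr (r - 1) * 2 powr (q + \<mu>) \<le> 1"
    proof -
      have "(c / d * m k powr ((r - 1) / q) * 2 powr (r / (r - 1))) powr q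
          = (c / d) powr q * (m k powr ((r - 1) / q)) powr q * (2 powr (r / (r - 1))) powr q"
        using assms by (simp only: powr_mult)
      also have "(m k powr ((r - 1) / q)) powr q = m k powr (r - 1)"
        using assms by (simp add: powr_powr)
      also have "(2 powr (r / (r - 1))) powr q = 2 powr (q + \<mu>)"
        by (simp only: powr_powr \<open>r / (r - 1) * q = q + \<mu>\<close>)
      finally show ?thesis
        using \<open>(c / d * m k powr ((r - 1) / q) * 2 powr (r / (r - 1))) powr q \<le> 1 powr q\<close> by simp
    qed
    moreover have "0 < (2::real) powr (q + \<mu>)" by simp
    ultimately show ?thesis
      unfolding powr_minus_divide by (simp only: pos_le_divide_eq)
  qed
  have decay: "m (lev n) \<le> m k * 2 powr (- (real n * \<mu>))" for n
  proof (induction n)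
    case 0
    then show ?case by (simp add: lev_def)
  next
    case (Suc n)
    have half: "2 powr (- real n) = 2 * 2 powr (- real (Suc n))"
    proof -
      have "(2::real) powr (1 + - real (Suc n)) = 2 * 2 powr (- real (Suc n))"
        unfolding powr_add by simp
      then show ?thesis by simp
    qed
    have "(k + d * (1 - y)) - (k + d * (1 - 2 * y)) = d * y" for y
      by (simp add: algebra_simps)
    then have gap: "lev (Suc n) - lev n = d * 2 powr (- real (Suc n))"
      unfolding lev_def half by blast
    have "k \<le> lev n"
    proof -
      have "(2::real) powr (- real n) \<le> 2 powr 0"
        by (intro powr_mono) auto
      then show ?thesis
        using \<open>0 < d\<close> by (simp add: lev_def)
    qed
    moreover have "lev n < lev (Suc n)"
    proof -
      have "0 < d * 2 powr (- real (Suc n))"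
        using \<open>0 < d\<close> by simp
      then show ?thesis
        using gap by linarith
    qed
    ultimately have "m (lev (Suc n)) \<le> (c / (d * 2 powr (- real (Suc n)))) powr q * m (lev n) powr r"
      using step[of "lev n" "lev (Suc n)"] by (simp only: gap)
    also have "\<dots> \<le> (c / (d * 2 powr (- real (Suc n)))) powr q * (m k * 2 powr (- (real n * \<mu>))) powr r"
      using Suc m_nonneg \<open>1 < r\<close> by (intro mult_left_mono powr_mono2) auto
    also have "c / (d * 2 powr (- real (Suc n))) = c / d * 2 powr real (Suc n)"
    proof -
      have "c / (d * (1 / y)) = c / d * y" for y by simp
      then show ?thesis unfolding powr_minus_divide by blast
    qed
    also have "(c / d * 2 powr real (Suc n)) powr q * (m k * 2 powr (- (real n * \<mu>))) powr r
        = ((c / d) powr q * m k powr (r - 1)) * (m k * 2 powr (real (Suc n) * q - real n * \<mu> * r))"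
    proof -
      have "(c / d * 2 powr real (Suc n)) powr q = (c / d) powr q * 2 powr (real (Suc n) * q)"
        using assms by (subst powr_mult) (auto simp: powr_powr)
      moreover have "(m k * 2 powr (- (real n * \<mu>))) powr r = m k powr r * 2 powr (- (real n * \<mu>) * r)"
        using mk by (subst powr_mult) (auto simp: powr_powr)
      moreover have "m k powr r = m k powr (r - 1) * m k"
        using mk by (simp add: powr_diff)
      moreover have "2 powr (real (Suc n) * q - real n * \<mu> * r) = 2 powr (real (Suc n) * q) * 2 powr (- (real n * \<mu>) * r)"
        unfolding powr_add[symmetric] by simp
      ultimately show ?thesis
        by (simp only: ac_simps)
    qed
    also have "\<dots> \<le> 2 powr (- (q + \<mu>)) * (m k * 2 powr (real (Suc n) * q - real n * \<mu> * r))"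
      using mk by (intro mult_right_mono small) auto
    also have "\<dots> = m k * 2 powr (- (q + \<mu>) + (real (Suc n) * q - real n * \<mu> * r))"
      unfolding powr_add by simp
    also have "- (q + \<mu>) + (real (Suc n) * q - real n * \<mu> * r) = - (real (Suc n) * \<mu>)"
      unfolding \<mu>(2)[symmetric] by (simp add: algebra_simps)
    finally show ?case .
  qed
  have "(\<lambda>n. m k * (2 powr (- \<mu>)) ^ n) \<longlonglongrightarrow> m k * 0"
    using \<mu>(1) by (intro tendsto_intros LIMSEQ_power_zero) (simp add: powr_minus inverse_less_1_iff)
  then have lim: "(\<lambda>n. m k * 2 powr (- (real n * \<mu>))) \<longlonglongrightarrow> 0"
    by (simp add: powr_realpow[symmetric] powr_powr mult.commute)
  have "m (k + d) \<le> 0"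
  proof (rule LIMSEQ_le_const[OF lim], intro exI allI impI)
    fix n :: nat
    have "m (k + d) \<le> m (lev n)"
      using \<open>0 < d\<close> by (intro m_anti) (simp add: lev_def mult_left_le)
    then show "m (k + d) \<le> m k * 2 powr (- (real n * \<mu>))"
      using decay[of n] by linarith
  qed
  then show ?thesis
    using m_nonneg[of "k + d"] by simp
qed

context weak_poisson
begin

lemma Lq_bound:
  assumes "smooth_real G G'" "G 0 = 0" "\<And>s. \<bar>G' s\<bar> \<le> 1"
  shows "integrable M (\<lambda>x. \<bar>G (u x)\<bar> powr q)"
    and "(\<integral>x. \<bar>G (u x)\<bar> powr q \<partial>M) \<le> (S * (\<integral>x. (G' (u x))\<^sup>2 * (norm (V x))\<^sup>2 \<partial>M)) powr (q / 2)"
proof -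
  have [measurable]: "(\<lambda>x. G (u x)) \<in> borel_measurable M"
    using smooth_real_continuous(1)[OF assms(1)] M_measurable(1) by (rule continuous_comp_meas)
  note sob = energy_sobolev[OF assms]
  show "integrable M (\<lambda>x. \<bar>G (u x)\<bar> powr q)"
    using sob by (intro integrableI_nonneg) (auto simp: less_top[symmetric] top_unique)
  show "(\<integral>x. \<bar>G (u x)\<bar> powr q \<partial>M) \<le> (S * (\<integral>x. (G' (u x))\<^sup>2 * (norm (V x))\<^sup>2 \<partial>M)) powr (q / 2)"
    using sob by (intro integral_real_bounded) auto
qed

lemma integrable_powr_u: "integrable M (\<lambda>x. \<bar>u x\<bar> powr q)"
  using Lq_bound(1)[OF smooth_real_linear[of 1]] by simp

text \<open>The equation tested with \<open>u\<close> and Hoelder for the dual exponents \<open>q\<close> and \<open>2 N / (N + 2)\<close> bound the energy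
by the product of the two norms; Sobolev bounds the square of the first norm by the energy.\<close>

lemma solution_norm_le_source_norm: "Lp_norm \<Omega> q u \<le> S * Lp_norm \<Omega> (2 * N / (N + 2)) g"
proof -
  define p where "p = 2 * N / (N + 2)"
  have p: "0 < p" "1 / p + 1 / q = 1"
    using N_gt_2 by (auto simp: p_def q_eq field_simps)
  have int_g: "integrable M (\<lambda>x. \<bar>g x\<bar> powr p)"
  proof (rule integrable_const_bound)
    show "AE x in M. norm (\<bar>g x\<bar> powr p) \<le> K powr p"
      using g_bound by eventually_elim (use p in \<open>auto intro: powr_mono2\<close>)
  qed measurable
  define A where "A = (\<integral>x. \<bar>u x\<bar> powr q \<partial>M)"
  have A: "0 \<le> A" unfolding A_def by (intro integral_nonneg_AE) auto
  have "(\<integral>x. (norm (V x))\<^sup>2 \<partial>M) = (\<integral>x. g x * u x \<partial>M)"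
    using energy_identity[OF smooth_real_linear[of 1]] by simp
  also have "\<dots> \<le> (\<integral>x. \<bar>g x * u x\<bar> \<partial>M)"
    using int_G(2)[OF smooth_real_linear[of 1]] by (intro integral_mono) auto
  also have "\<dots> \<le> Lp_norm \<Omega> p g * A powr (1 / q)"
    unfolding Lp_norm_def A_def using p q_eq(3) int_g integrable_powr_u
    by (intro Holder_integral) auto
  finally have V_le: "(\<integral>x. (norm (V x))\<^sup>2 \<partial>M) \<le> Lp_norm \<Omega> p g * A powr (1 / q)" .
  have "A \<le> (S * (\<integral>x. (norm (V x))\<^sup>2 \<partial>M)) powr (q / 2)"
    unfolding A_def using Lq_bound(2)[OF smooth_real_linear[of 1]] by simp
  also have "\<dots> \<le> (S * Lp_norm \<Omega> p g * A powr (1 / q)) powr (q / 2)"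
    unfolding mult.assoc using q_eq(3) S_pos V_le
    by (intro powr_mono2 mult_left_mono mult_nonneg_nonneg integral_nonneg_AE) auto
  finally have "A powr (1 / q) \<le> S * Lp_norm \<Omega> p g"
    using A q_eq(3) S_pos by (intro powr_self_improvement) (auto simp: Lp_norm_def)
  then show ?thesis
    by (simp add: Lp_norm_def A_def p_def)
qed

definition superlevel :: "real \<Rightarrow> real" where
  "superlevel t = measure M {x \<in> space M. t < u x}"

text \<open>The equation is tested with a truncation \<open>T(u)\<close> that is active only where \<open>u > k\<close>. Since \<open>T'\<close> lies
between \<open>0\<close> and \<open>1\<close>, its square is at most \<open>T'\<close>, so the energy of \<open>T(u)\<close> is at most
\<open>K \<integral> T(u)\<close>. Hoelder on the set \<open>u > k\<close> brings in the measure of this set with the power \<open>1 - 1 / q\<close>,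
and self-improvement turns it into the power \<open>q - 1\<close> for the \<open>q\<close>-th power integral. The latter controls the
measure of \<open>u > h\<close>, where \<open>T(u)\<close> is large.\<close>

lemma superlevel_step:
  assumes "0 \<le> k" "k < h"
  shows "superlevel h \<le> (exp 1 * S * K / (h - k)) powr q * superlevel k powr (q - 1)"
proof -
  obtain T T' where T: "smooth_real T T'" "\<And>s. 0 \<le> T' s" "\<And>s. T' s \<le> 1"
    "\<And>s. s \<le> k \<Longrightarrow> T s = 0" "\<And>s. 0 \<le> T s" "\<And>s. h \<le> s \<Longrightarrow> (h - k) / exp 1 \<le> T s"
    using smooth_truncation[OF assms] by blast
  have T0: "T 0 = 0" using T(4) assms by simp
  have T'1: "\<bar>T' s\<bar> \<le> 1" for s using T(2,3)[of s] by simp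
  note G = T(1) T0 T'1
  have [measurable]: "(\<lambda>x. T (u x)) \<in> borel_measurable M" "(\<lambda>x. T' (u x)) \<in> borel_measurable M"
    using G_measurable[OF G M_measurable(1)] by auto
  define E where "E t = {x \<in> space M. t < u x}" for t
  have E [measurable]: "E t \<in> sets M" for t
    unfolding E_def by measurable
  have E_sub: "E t \<inter> \<Omega> = E t" for t
    by (auto simp: E_def)
  have lev: "superlevel t = measure M (E t)" for t
    by (simp add: superlevel_def E_def)
  define A where "A = (\<integral>x. \<bar>T (u x)\<bar> powr q \<partial>M)"
  have A: "0 \<le> A" unfolding A_def by (intro integral_nonneg_AE) auto
  define mk where "mk = superlevel k powr ((q - 1) / q)"
  have q: "2 < q" by (rule q_eq)
  have int_T'V: "integrable M (\<lambda>x. T' (u x) * (norm (V x))\<^sup>2)" "integrable M (\<lambda>x. (T' (u x))\<^sup>2 * (norm (V x))\<^sup>2)"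
  proof -
    have 1: "norm (T' (u x) * (norm (V x))\<^sup>2) \<le> norm ((norm (V x))\<^sup>2)" for x
      using mult_right_mono[OF T'1[of "u x"], of "(norm (V x))\<^sup>2"] by (simp add: abs_mult)
    show "integrable M (\<lambda>x. T' (u x) * (norm (V x))\<^sup>2)"
      using int_square(2) by (rule Bochner_Integration.integrable_bound) (use 1 in \<open>auto intro!: AE_I2\<close>)
    have 2: "norm ((T' (u x))\<^sup>2 * (norm (V x))\<^sup>2) \<le> norm ((norm (V x))\<^sup>2)" for x
      using mult_right_mono[of "(T' (u x))\<^sup>2" 1 "(norm (V x))\<^sup>2"] T'1[of "u x"] by (simp add: abs_square_le_1)
    show "integrable M (\<lambda>x. (T' (u x))\<^sup>2 * (norm (V x))\<^sup>2)"
      using int_square(2) by (rule Bochner_Integration.integrable_bound) (use 2 in \<open>auto intro!: AE_I2\<close>)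
  qed
  have "(\<integral>x. (T' (u x))\<^sup>2 * (norm (V x))\<^sup>2 \<partial>M) \<le> (\<integral>x. T' (u x) * (norm (V x))\<^sup>2 \<partial>M)"
    using int_T'V(2,1)
  proof (rule integral_mono)
    fix x
    have "(T' (u x))\<^sup>2 \<le> T' (u x)"
      using mult_left_mono[OF T(3) T(2), of "u x" "u x"] by (simp add: power2_eq_square)
    then show "(T' (u x))\<^sup>2 * (norm (V x))\<^sup>2 \<le> T' (u x) * (norm (V x))\<^sup>2"
      by (intro mult_right_mono) auto
  qed
  also have "\<dots> = (\<integral>x. g x * T (u x) \<partial>M)"
    by (rule energy_identity[OF G])
  also have "\<dots> \<le> (\<integral>x. K * T (u x) \<partial>M)"
  proof (rule integral_mono_AE)
    show "AE x in M. g x * T (u x) \<le> K * T (u x)"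
      using g_bound by eventually_elim (use T(5) in \<open>auto intro!: mult_right_mono\<close>)
  qed (use int_G[OF G] in auto)
  also have "\<dots> = K * (\<integral>x. \<bar>T (u x) * indicator (E k) x\<bar> \<partial>M)"
    using T(4,5) by (auto simp: E_def indicator_def not_less intro!: Bochner_Integration.integral_cong arg_cong[where f="\<lambda>x. K * x"])
  also have "\<dots> \<le> K * (A powr (1 / q) * (\<integral>x. \<bar>indicator (E k) x :: real\<bar> powr (q / (q - 1)) \<partial>M) powr (1 / (q / (q - 1))))"
    unfolding A_def using q K_nonneg Lq_bound(1)[OF G]
    by (intro mult_left_mono Holder_integral) (auto simp: field_simps indicator_def intro!: integrable_const_bound[of _ 1])
  also have "(\<integral>x. \<bar>indicator (E k) x :: real\<bar> powr (q / (q - 1)) \<partial>M) = superlevel k"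
  proof -
    have "(\<lambda>x. \<bar>indicator (E k) x :: real\<bar> powr (q / (q - 1))) = indicator (E k)"
      by (auto simp: indicator_def fun_eq_iff)
    then show ?thesis
      using E by (simp add: lev E_sub)
  qed
  also have "1 / (q / (q - 1)) = (q - 1) / q" by simp
  finally have energy_le: "(\<integral>x. (T' (u x))\<^sup>2 * (norm (V x))\<^sup>2 \<partial>M) \<le> K * mk * A powr (1 / q)"
    by (simp add: mk_def ac_simps)
  have "A \<le> (S * (\<integral>x. (T' (u x))\<^sup>2 * (norm (V x))\<^sup>2 \<partial>M)) powr (q / 2)"
    unfolding A_def by (rule Lq_bound(2)[OF G])
  also have "\<dots> \<le> ((S * K * mk) * A powr (1 / q)) powr (q / 2)"
    using energy_le S_pos q
    by (intro powr_mono2) (auto simp: mult.assoc intro!: mult_nonneg_nonneg integral_nonneg_AE)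
  finally have A_root: "A powr (1 / q) \<le> S * K * mk"
    using A q S_pos K_nonneg by (intro powr_self_improvement) (auto simp: mk_def)
  have A_le: "A \<le> (S * K) powr q * superlevel k powr (q - 1)"
  proof -
    have "A = (A powr (1 / q)) powr q" using A q by (simp add: powr_powr)
    also have "\<dots> \<le> (S * K * mk) powr q"
      using A_root q by (intro powr_mono2) auto
    also have "\<dots> = (S * K) powr q * superlevel k powr (q - 1)"
      using S_pos K_nonneg q by (simp add: powr_mult mk_def powr_powr)
    finally show ?thesis .
  qed
  have "((h - k) / exp 1) powr q * superlevel h = (\<integral>x. ((h - k) / exp 1) powr q * indicator (E h) x \<partial>M)"
    using E by (simp add: lev E_sub)
  also have "\<dots> \<le> A"
    unfolding A_def
  proof (rule integral_mono)
    fix x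
    show "((h - k) / exp 1) powr q * indicator (E h) x \<le> \<bar>T (u x)\<bar> powr q"
      using T(6)[of "u x"] q assms by (auto simp: indicator_def E_def intro!: powr_mono2)
  qed (use Lq_bound(1)[OF G] E in \<open>auto simp: less_top[symmetric]\<close>)
  also note A_le
  finally have "superlevel h \<le> (S * K) powr q * superlevel k powr (q - 1) / ((h - k) / exp 1) powr q"
    using assms by (simp add: field_simps)
  also have "\<dots> = ((S * K) / ((h - k) / exp 1)) powr q * superlevel k powr (q - 1)"
  proof -
    have "((S * K) / ((h - k) / exp 1)) powr q = (S * K) powr q / ((h - k) / exp 1) powr q"
      by (rule powr_divide)
    then show ?thesis
      by (simp only: times_divide_eq_left)
  qed
  also have "(S * K) / ((h - k) / exp 1) = exp 1 * S * K / (h - k)"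
    by simp
  finally show ?thesis .
qed

lemma upper_bound:
  assumes "0 \<le> k" "0 < d" "superlevel k \<le> \<mu>"
    and d: "exp 1 * S * K * \<mu> powr ((q - 2) / q) * 2 powr ((q - 1) / (q - 2)) \<le> d"
  shows "AE x in M. u x \<le> k + d"
proof -
  have q: "2 < q" by (rule q_eq)
  have "superlevel (k + d) = 0"
  proof (rule stampacchia_iteration[where c="exp 1 * S * K" and q=q and r="q - 1"])
    show "0 \<le> superlevel t" for t by (simp add: superlevel_def)
    show "superlevel t \<le> superlevel s" if "s \<le> t" for s t
      unfolding superlevel_def
    proof (rule finite_measure_mono)
      show "{x \<in> space M. s < u x} \<in> sets M" by measurable
    qed (use that in auto)
    show "superlevel t \<le> (exp 1 * S * K / (t - s)) powr q * superlevel s powr (q - 1)" if "k \<le> s" "s < t" for s t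
      using that assms(1) by (intro superlevel_step) auto
    have "exp 1 * S * K * superlevel k powr ((q - 2) / q) * 2 powr ((q - 1) / (q - 2))
        \<le> exp 1 * S * K * \<mu> powr ((q - 2) / q) * 2 powr ((q - 1) / (q - 2))"
      using assms(3) q S_pos K_nonneg
      by (intro mult_right_mono mult_left_mono powr_mono2) (auto simp: superlevel_def)
    also have "\<dots> \<le> d" by (rule d)
    finally show "exp 1 * S * K * superlevel k powr ((q - 1 - 1) / q) * 2 powr ((q - 1) / (q - 1 - 1)) \<le> d"
      by simp
  qed (use q S_pos K_nonneg assms in auto)
  then have "emeasure M {x \<in> space M. k + d < u x} = 0"
    by (simp add: superlevel_def emeasure_eq_measure)
  moreover have "{x \<in> space M. k + d < u x} \<in> sets M"
    by measurable
  ultimately have "AE x in M. \<not> k + d < u x"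
    by (subst AE_iff_measurable[where N="{x \<in> space M. k + d < u x}"]) auto
  then show ?thesis
    by (simp add: not_less)
qed

lemma superlevel_le: "superlevel t \<le> measure M {x \<in> space M. t < \<bar>u x\<bar>}"
  unfolding superlevel_def
proof (rule finite_measure_mono)
  show "{x \<in> space M. t < \<bar>u x\<bar>} \<in> sets M" by measurable
qed auto

lemma chebyshev_powr:
  assumes "0 < t"
  shows "measure M {x \<in> space M. t < \<bar>u x\<bar>} \<le> (Lp_norm \<Omega> q u / t) powr q"
proof -
  define E where "E = {x \<in> space M. t < \<bar>u x\<bar>}"
  have E: "E \<in> sets M" unfolding E_def by measurable
  have q: "2 < q" by (rule q_eq)
  have "t powr q * measure M E = (\<integral>x. t powr q * indicator E x \<partial>M)"
    using E by (simp add: E_def Int_def conj_commute)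
  also have "\<dots> \<le> (\<integral>x. \<bar>u x\<bar> powr q \<partial>M)"
  proof (rule integral_mono)
    show "t powr q * indicator E x \<le> \<bar>u x\<bar> powr q" for x
      using assms q by (auto simp: E_def indicator_def intro!: powr_mono2)
  qed (use E integrable_powr_u in \<open>auto simp: less_top[symmetric]\<close>)
  also have "\<dots> = Lp_norm \<Omega> q u powr q"
    using q by (simp add: Lp_norm_def powr_powr integral_nonneg_AE)
  finally show ?thesis
    using assms unfolding E_def[symmetric] by (subst powr_divide) (auto simp: Lp_norm_def field_simps)
qed

lemma negated: "weak_poisson \<Omega> (\<lambda>x. - u x) (\<lambda>x. - g x) (\<lambda>x. - V x) K"
proof
  obtain \<phi> where \<phi>: "\<And>k::nat. \<phi> k \<in> test_functions \<Omega>"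
    "(\<lambda>k. \<integral>x. (u x - \<phi> k x)\<^sup>2 \<partial>M) \<longlonglongrightarrow> 0"
    "(\<lambda>k. \<integral>x. (norm (V x - grad (\<phi> k) x))\<^sup>2 \<partial>M) \<longlonglongrightarrow> 0"
    using approx by blast
  have neg: "(\<lambda>x. - \<phi> k x) \<in> test_functions \<Omega>" "grad (\<lambda>x. - \<phi> k x) x = - grad (\<phi> k) x" for k x
    using test_functions_compose(1)[OF \<phi>(1) smooth_real_linear[of "-1"], of k]
      test_functions_compose(2)[OF \<phi>(1) smooth_real_linear[of "-1"], of k x] by auto
  show "\<exists>\<phi>. (\<forall>k::nat. \<phi> k \<in> test_functions \<Omega>) \<and>
     (\<lambda>k. \<integral>x. (- u x - \<phi> k x)\<^sup>2 \<partial>M) \<longlonglongrightarrow> 0 \<and>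
     (\<lambda>k. \<integral>x. (norm (- V x - grad (\<phi> k) x))\<^sup>2 \<partial>M) \<longlonglongrightarrow> 0"
  proof (intro exI[of _ "\<lambda>k x. - \<phi> k x"] conjI allI)
    have "(- u x - - \<phi> k x)\<^sup>2 = (u x - \<phi> k x)\<^sup>2" for k x
      by (simp add: power2_commute)
    then show "(\<lambda>k. \<integral>x. (- u x - - \<phi> k x)\<^sup>2 \<partial>M) \<longlonglongrightarrow> 0"
      using \<phi>(2) by simp
    have "norm (- V x - grad (\<lambda>x. - \<phi> k x) x) = norm (V x - grad (\<phi> k) x)" for k x
      by (simp add: neg norm_minus_commute)
    then show "(\<lambda>k. \<integral>x. (norm (- V x - grad (\<lambda>x. - \<phi> k x) x))\<^sup>2 \<partial>M) \<longlonglongrightarrow> 0"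
      using \<phi>(3) by simp
  qed (rule neg)
  show "square_integrable \<Omega> (\<lambda>x. - u x)" "square_integrable \<Omega> (\<lambda>x. - V x)"
    using M_measurable int_square by (simp_all add: square_integrable_def)
  show "(\<lambda>x. - g x) \<in> borel_measurable M"
    by measurable
  show "AE x in M. \<bar>- g x\<bar> \<le> K"
    using g_bound by simp
  show "(\<integral>x. - V x \<bullet> grad \<phi> x \<partial>M) = (\<integral>x. - g x * \<phi> x \<partial>M)" if "\<phi> \<in> test_functions \<Omega>" for \<phi>
    using weak_eq[OF that] by simp
qed (rule dim open_dom bounded_dom K_nonneg)+

text \<open>In the application \<open>m\<close> is the essential supremum of \<open>\<bar>u\<bar>\<close>. The iteration starts at half of it, where Chebyshev's
inequality bounds the superlevel sets of \<open>u\<close> and \<open>-u\<close> by \<open>(2 U / m) powr q\<close>, with \<open>U\<close> the critical norm. The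
height \<open>D\<close> that the iteration needs above level \<open>m / 2\<close> cannot be less than \<open>m / 2\<close>, and this is the claim.\<close>

lemma sup_norm_bound:
  assumes m: "0 < m" and m_least: "\<And>c. AE x in M. \<bar>u x\<bar> \<le> c \<Longrightarrow> m \<le> c"
  shows "m powr (q - 1) \<le> 2 powr (q - 1) * exp 1 * S * 2 powr ((q - 1) / (q - 2)) * K * Lp_norm \<Omega> q u powr (q - 2)"
proof -
  interpret neg: weak_poisson \<Omega> "\<lambda>x. - u x" "\<lambda>x. - g x" "\<lambda>x. - V x" K
    by (rule negated)
  have q: "2 < q" by (rule q_eq)
  define U where "U = Lp_norm \<Omega> q u"
  have U: "0 \<le> U" by (simp add: U_def Lp_norm_def)
  define \<mu> where "\<mu> = (U / (m / 2)) powr q"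
  define D where "D = exp 1 * S * K * \<mu> powr ((q - 2) / q) * 2 powr ((q - 1) / (q - 2))"
  have D: "0 \<le> D" using S_pos K_nonneg by (simp add: D_def)
  have "measure M {x \<in> space M. m / 2 < \<bar>u x\<bar>} \<le> \<mu>"
    unfolding \<mu>_def U_def using m by (intro chebyshev_powr) simp
  moreover have "superlevel (m / 2) \<le> measure M {x \<in> space M. m / 2 < \<bar>u x\<bar>}"
    "neg.superlevel (m / 2) \<le> measure M {x \<in> space M. m / 2 < \<bar>u x\<bar>}"
    using superlevel_le[of "m / 2"] neg.superlevel_le[of "m / 2"] by simp_all
  ultimately have lev: "superlevel (m / 2) \<le> \<mu>" "neg.superlevel (m / 2) \<le> \<mu>"
    by linarith+
  have "m / 2 \<le> D"
  \<comment> \<open>the iteration needs a positive height, which \<open>D\<close> itself is not known to be\<close>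
  proof (rule dense_ge)
    fix d assume d: "D < d"
    then have pos: "0 \<le> m / 2" "0 < d" and le: "D \<le> d"
      using m D by auto
    have "AE x in M. u x \<le> m / 2 + d"
      using pos lev(1) le unfolding D_def by (rule upper_bound)
    moreover have "AE x in M. - u x \<le> m / 2 + d"
      using pos lev(2) le unfolding D_def by (rule neg.upper_bound)
    ultimately have "AE x in M. \<bar>u x\<bar> \<le> m / 2 + d"
      by eventually_elim auto
    from m_least[OF this] show "m / 2 \<le> d" by simp
  qed
  also have "\<mu> powr ((q - 2) / q) = (2 * U / m) powr (q - 2)"
    using q by (simp add: \<mu>_def powr_powr mult.commute)
  then have "D = exp 1 * S * 2 powr ((q - 1) / (q - 2)) * K * (2 powr (q - 2) * U powr (q - 2) / m powr (q - 2))"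
    using m U by (simp add: D_def powr_divide powr_mult)
  finally have "m * m powr (q - 2) \<le> 2 * 2 powr (q - 2) * exp 1 * S * 2 powr ((q - 1) / (q - 2)) * K * U powr (q - 2)"
    using m by (simp add: field_simps)
  moreover have "x * x powr (q - 2) = x powr (q - 1)" if "0 < x" for x
    using that by (simp add: powr_mult_base)
  ultimately show ?thesis
    using m by (simp add: U_def)
qed

end

section \<open>The semilinear problem\<close>

lemma abs_le_max_abs:
  fixes f :: "real^'n \<Rightarrow> real \<Rightarrow> real"
  assumes f: "continuous_on (closure \<Omega> \<times> UNIV) (\<lambda>(x, s). f x s)" and "bounded \<Omega>" "compact T"
    and "x \<in> closure \<Omega>" "s \<in> T"
  shows "\<bar>f x s\<bar> \<le> max_abs \<Omega> f T"
proof -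
  have "compact (closure \<Omega> \<times> T)"
    using assms by (intro compact_Times) (auto simp: compact_closure)
  moreover have "continuous_on (closure \<Omega> \<times> T) (\<lambda>z. \<bar>case z of (x, s) \<Rightarrow> f x s\<bar>)"
    using f by (intro continuous_intros) (auto intro: continuous_on_subset)
  ultimately have "compact ((\<lambda>z. \<bar>case z of (x, s) \<Rightarrow> f x s\<bar>) ` (closure \<Omega> \<times> T))"
    by (intro compact_continuous_image)
  then have "bdd_above ((\<lambda>z. \<bar>case z of (x, s) \<Rightarrow> f x s\<bar>) ` (closure \<Omega> \<times> T))"
    by (intro bounded_imp_bdd_above compact_imp_bounded)
  from cSUP_upper[OF _ this, of "(x, s)"] show ?thesis
    using assms(4,5) by (simp add: max_abs_def case_prod_unfold)
qed

lemma max_abs_mono: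
  fixes f :: "real^'n \<Rightarrow> real \<Rightarrow> real"
  assumes f: "continuous_on (closure \<Omega> \<times> UNIV) (\<lambda>(x, s). f x s)" and "bounded \<Omega>" "compact T'"
    and "\<Omega> \<noteq> {}" "T \<noteq> {}" "T \<subseteq> T'"
  shows "max_abs \<Omega> f T \<le> max_abs \<Omega> f T'"
  unfolding max_abs_def[of _ _ T]
  using assms abs_le_max_abs[OF assms(1-3)] by (intro cSUP_least) auto

text \<open>The graph map \<open>x \<mapsto> (x, u x)\<close> is measurable into the set on which \<open>f\<close> is jointly continuous.\<close>

lemma nemytskii_measurable:
  fixes f :: "real^'n \<Rightarrow> real \<Rightarrow> real"
  assumes f: "continuous_on (closure \<Omega> \<times> UNIV) (\<lambda>(x, s). f x s)"
    and [measurable]: "u \<in> borel_measurable (lebesgue_on \<Omega>)"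
  shows "(\<lambda>x. f x (u x)) \<in> borel_measurable (lebesgue_on \<Omega>)"
proof -
  have [measurable]: "(\<lambda>x. x) \<in> borel_measurable (lebesgue_on \<Omega>)"
    by (intro continuous_imp_measurable_lebesgue_on continuous_intros)
  have "(\<lambda>x. (x, u x)) \<in> lebesgue_on \<Omega> \<rightarrow>\<^sub>M restrict_space borel (closure \<Omega> \<times> UNIV)"
    using closure_subset by (intro measurable_restrict_space2) (auto simp: space_restrict_space)
  from measurable_compose[OF this borel_measurable_continuous_on_restrict[OF f]] show ?thesis
    by simp
qed

text \<open>Positivity excludes the default value \<open>0\<close> of \<open>real_of_ereal\<close> at an infinite essential supremum.\<close>

lemma Linf_norm_least:
  assumes u: "u \<in> borel_measurable (lebesgue_on \<Omega>)" and pos: "0 < Linf_norm \<Omega> u"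
  shows "AE x in lebesgue_on \<Omega>. \<bar>u x\<bar> \<le> Linf_norm \<Omega> u"
    and "AE x in lebesgue_on \<Omega>. \<bar>u x\<bar> \<le> c \<Longrightarrow> Linf_norm \<Omega> u \<le> c"
proof -
  define e where "e = esssup (lebesgue_on \<Omega>) (\<lambda>x. ereal \<bar>u x\<bar>)"
  have e: "e = ereal (Linf_norm \<Omega> u)"
    using pos unfolding Linf_norm_def e_def[symmetric] by (cases e) auto
  show "AE x in lebesgue_on \<Omega>. \<bar>u x\<bar> \<le> Linf_norm \<Omega> u"
    using esssup_AE[of "\<lambda>x. ereal \<bar>u x\<bar>" "lebesgue_on \<Omega>"] unfolding e_def[symmetric] e by simp
  assume "AE x in lebesgue_on \<Omega>. \<bar>u x\<bar> \<le> c"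
  then have "e \<le> ereal c"
    unfolding e_def using u by (intro esssup_I) auto
  then show "Linf_norm \<Omega> u \<le> c"
    by (simp add: e)
qed

theorem theorem2p1:
  fixes \<Omega> :: "(real^'n) set" and \<alpha> c0 N :: real
  defines "N \<equiv> real CARD('n)"
  assumes "CARD('n) > 2"
    and "open \<Omega>" "bounded \<Omega>" "connected \<Omega>" "\<Omega> \<noteq> {}"
    and "0 < \<alpha>" "\<alpha> \<le> 1" "C2_holder_boundary \<alpha> \<Omega>"
    and "c0 > 0"
  shows "\<exists>C :: real \<Rightarrow> real. (\<forall>\<theta>\<in>{0<..1}. C \<theta> > 0) \<and>
    (\<forall>(f :: real^'n \<Rightarrow> real \<Rightarrow> real) (M0::real) (s0::real).
       continuous_on (closure \<Omega> \<times> UNIV) (\<lambda>(x, s). f x s) \<and>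
       ((\<lambda>s. max_abs \<Omega> f {s} / \<bar>s\<bar> powr (crit_exp N - 1)) \<longlongrightarrow> 0) at_infinity \<and>
       Limsup at_top (\<lambda>s. ereal (max_abs \<Omega> f {-s..s} / max_abs \<Omega> f {-s, s})) \<le> ereal c0 \<and>
       M0 > 0 \<and> s0 > 0 \<and> (\<forall>s. \<bar>s\<bar> > s0 \<longrightarrow> max_abs \<Omega> f {s} > M0)
       \<longrightarrow>
       (\<exists>C1>0. \<forall>u. weak_solution \<Omega> f u \<and> u \<in> Linf \<Omega> \<longrightarrow>
          Linf_norm \<Omega> u \<le> C1 \<or>
          (Linf_norm \<Omega> u > s0 \<and>
           (\<forall>\<theta>\<in>{0<..1}.
              h_fun \<Omega> f (Linf_norm \<Omega> u) \<le>
                C \<theta> * Lp_norm \<Omega> (crit_exp N) u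
                        powr ((N + 2) / (N - 2) * (2 * (1 - \<theta>) / (N - 2 * \<theta>)))
                    * Lp_norm \<Omega> (2 * N / (N + 2)) (\<lambda>x. f x (u x))
                        powr (2 * (1 + \<theta>) / (N - 2 * \<theta>))) \<and>
           h_fun \<Omega> f (Linf_norm \<Omega> u) \<le>
             C 1 * Lp_norm \<Omega> (2 * N / (N + 2)) (\<lambda>x. f x (u x)) powr (4 / (N - 2)))))"
proof -
  have N: "2 < N" using assms(2) by (simp add: N_def)
  define q where "q = crit_exp N"
  have q: "2 < q" "q - 2 = 4 / (N - 2)"
    using N by (auto simp: q_def crit_exp_def field_simps)
  define S where "S = (2 * (N - 1) / (N - 2))\<^sup>2"
  have S: "0 < S" using N by (simp add: S_def)
  define E where "E = 2 powr (q - 1) * exp 1 * S * 2 powr ((q - 1) / (q - 2))"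
  have E: "0 < E" using S by (simp add: E_def)
  define a where "a \<theta> = (N + 2) / (N - 2) * (2 * (1 - \<theta>) / (N - 2 * \<theta>))" for \<theta> :: real
  define b where "b \<theta> = 2 * (1 + \<theta>) / (N - 2 * \<theta>)" for \<theta> :: real
  have ab: "a \<theta> + b \<theta> = q - 2" "0 \<le> b \<theta>" if "\<theta> \<in> {0<..1}" for \<theta>
  proof -
    have nz: "N - 2 \<noteq> 0" "N - 2 * \<theta> \<noteq> 0" using N that by auto
    have "(N + 2) * (2 * (1 - \<theta>)) + (2 * (1 + \<theta>)) * (N - 2) = 4 * (N - 2 * \<theta>)"
      by (simp add: algebra_simps)
    moreover have "P / X * (A / Y) + B / Y = (P * A + B * X) / (X * Y)" if "X \<noteq> 0" "Y \<noteq> 0" for P X A Y B :: real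
      using that by (simp add: field_simps)
    then have "a \<theta> + b \<theta> = ((N + 2) * (2 * (1 - \<theta>)) + (2 * (1 + \<theta>)) * (N - 2)) / ((N - 2) * (N - 2 * \<theta>))"
      unfolding a_def b_def using nz by blast
    moreover have "4 * (N - 2 * \<theta>) / ((N - 2) * (N - 2 * \<theta>)) = 4 / (N - 2)"
      using nz(2) by (rule nonzero_mult_divide_mult_cancel_right)
    ultimately show "a \<theta> + b \<theta> = q - 2"
      by (simp only: q(2))
    show "0 \<le> b \<theta>" using N that by (simp add: b_def)
  qed
  have ab1: "a 1 = 0" "b 1 = 4 / (N - 2)"
    by (simp_all add: a_def b_def)
  define C where "C \<theta> = E * (c0 + 1) * S powr b \<theta>" for \<theta>
  show ?thesis
    unfolding q_def[symmetric] a_def[symmetric] b_def[symmetric] ab1(2)[symmetric]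
  proof (intro exI[of _ C] conjI ballI allI impI)
    show "0 < C \<theta>" for \<theta>
      using E S \<open>c0 > 0\<close> by (simp add: C_def)
  next
    fix f :: "real^'n \<Rightarrow> real \<Rightarrow> real" and M0 s0 :: real
    assume "continuous_on (closure \<Omega> \<times> UNIV) (\<lambda>(x, s). f x s) \<and>
       ((\<lambda>s. max_abs \<Omega> f {s} / \<bar>s\<bar> powr (q - 1)) \<longlongrightarrow> 0) at_infinity \<and>
       Limsup at_top (\<lambda>s. ereal (max_abs \<Omega> f {-s..s} / max_abs \<Omega> f {-s, s})) \<le> ereal c0 \<and>
       M0 > 0 \<and> s0 > 0 \<and> (\<forall>s. \<bar>s\<bar> > s0 \<longrightarrow> max_abs \<Omega> f {s} > M0)"
    then have f: "continuous_on (closure \<Omega> \<times> UNIV) (\<lambda>(x, s). f x s)"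
      and lims: "Limsup at_top (\<lambda>s. ereal (max_abs \<Omega> f {-s..s} / max_abs \<Omega> f {-s, s})) \<le> ereal c0"
      and M0: "0 < M0" and s0: "0 < s0" and big: "\<And>s. \<bar>s\<bar> > s0 \<Longrightarrow> max_abs \<Omega> f {s} > M0"
      by auto
    have "ereal c0 < ereal (c0 + 1)" by simp
    with lims have "Limsup at_top (\<lambda>s. ereal (max_abs \<Omega> f {-s..s} / max_abs \<Omega> f {-s, s})) < ereal (c0 + 1)"
      by (rule le_less_trans)
    then have "\<forall>\<^sub>F s in at_top. ereal (max_abs \<Omega> f {-s..s} / max_abs \<Omega> f {-s, s}) < ereal (c0 + 1)"
      by (rule Limsup_lessD)
    \<comment> \<open>beyond \<open>s1\<close> the bound \<open>\<bar>f\<bar> \<le> (c0 + 1) max_abs \<Omega> f {-s, s}\<close> holds for all values in \<open>[-s, s]\<close>; this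
      determines the constant \<open>C1\<close>\<close>
    then obtain s1 where s1: "\<And>s. s1 \<le> s \<Longrightarrow> max_abs \<Omega> f {-s..s} / max_abs \<Omega> f {-s, s} < c0 + 1"
      by (auto simp: eventually_at_top_linorder)
    show "\<exists>C1>0. \<forall>u. weak_solution \<Omega> f u \<and> u \<in> Linf \<Omega> \<longrightarrow>
          Linf_norm \<Omega> u \<le> C1 \<or>
          (Linf_norm \<Omega> u > s0 \<and>
           (\<forall>\<theta>\<in>{0<..1}. h_fun \<Omega> f (Linf_norm \<Omega> u) \<le>
                C \<theta> * Lp_norm \<Omega> q u powr a \<theta> * Lp_norm \<Omega> (2 * N / (N + 2)) (\<lambda>x. f x (u x)) powr b \<theta>) \<and>
           h_fun \<Omega> f (Linf_norm \<Omega> u) \<le>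
             C 1 * Lp_norm \<Omega> (2 * N / (N + 2)) (\<lambda>x. f x (u x)) powr b 1)"
    proof (intro exI[of _ "max s0 s1"] conjI allI impI)
      show "0 < max s0 s1" using s0 by simp
    next
      fix u assume "weak_solution \<Omega> f u \<and> u \<in> Linf \<Omega>"
      then have sol: "weak_solution \<Omega> f u" and "u \<in> Linf \<Omega>" by auto
      then have u_meas: "u \<in> borel_measurable (lebesgue_on \<Omega>)"
        by (simp add: Linf_def)
      define m where "m = Linf_norm \<Omega> u"
      define F where "F = Lp_norm \<Omega> (2 * N / (N + 2)) (\<lambda>x. f x (u x))"
      define U where "U = Lp_norm \<Omega> q u"
      have main: "s0 < m \<and> (\<forall>\<theta>\<in>{0<..1}. h_fun \<Omega> f m \<le> C \<theta> * U powr a \<theta> * F powr b \<theta>) \<and> h_fun \<Omega> f m \<le> C 1 * F powr b 1"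
        if "max s0 s1 < m"
      proof -
        have m: "s0 < m" "s1 \<le> m" "0 < m" using that s0 by auto
        define K where "K = max_abs \<Omega> f {-m..m}"
        define K' where "K' = max_abs \<Omega> f {-m, m}"
        note Linf = Linf_norm_least[OF u_meas, folded m_def, OF m(3)]
        have K'pos: "0 < K'"
        proof -
          have "max_abs \<Omega> f {m} \<le> K'"
            unfolding K'_def using assms f by (intro max_abs_mono) auto
          then show ?thesis
            using big[of m] m M0 by simp
        qed
        have K_le: "K \<le> (c0 + 1) * K'"
          using s1[OF m(2)] K'pos by (simp add: K_def[symmetric] K'_def[symmetric] field_simps)
        have "K' \<le> K"
          unfolding K_def K'_def using assms f m by (intro max_abs_mono) auto
        have g_bound: "AE x in lebesgue_on \<Omega>. \<bar>f x (u x)\<bar> \<le> K"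
          using Linf(1) AE_space
        proof eventually_elim
          case (elim x)
          then have "x \<in> closure \<Omega>" "u x \<in> {-m..m}"
            using closure_subset[of \<Omega>] by (auto simp: space_restrict_space)
          then show ?case
            unfolding K_def using assms by (intro abs_le_max_abs[OF f]) auto
        qed
        interpret P: weak_poisson \<Omega> u "\<lambda>x. f x (u x)" "weak_grad \<Omega> u" K
        proof
          show "(\<lambda>x. f x (u x)) \<in> borel_measurable (lebesgue_on \<Omega>)"
            by (rule nemytskii_measurable[OF f u_meas])
          show "AE x in lebesgue_on \<Omega>. \<bar>f x (u x)\<bar> \<le> K"
            by (rule g_bound)
          show "0 \<le> K" using \<open>K' \<le> K\<close> K'pos by simp
        qed (use assms sol in \<open>auto simp: weak_solution_def H10_def H1_def\<close>)
        have const_eqs: "P.N = N" "P.q = q" "P.S = S"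
          by (simp_all add: P.q_def P.S_def P.N_def q_def S_def N_def)
        have U_le: "U \<le> S * F"
          using P.solution_norm_le_source_norm by (simp add: const_eqs U_def F_def)
        have sup: "m powr (q - 1) \<le> E * K * U powr (q - 2)"
          using P.sup_norm_bound[OF m(3) Linf(2)] by (simp add: const_eqs E_def U_def)
        \<comment> \<open>positivity of \<open>U\<close> matters for the power \<open>U powr 0\<close> in the case \<open>\<theta> = 1\<close>\<close>
        have "U \<noteq> 0"
        proof
          assume "U = 0"
          then have "m powr (q - 1) \<le> 0" using sup q by simp
          then show False using m(3) by simp
        qed
        then have U: "0 < U" by (simp add: U_def Lp_norm_def less_le)
        then have F: "0 < F" using U_le S by (meson less_le_trans zero_less_mult_pos)
        have "m powr (q - 1) \<le> E * ((c0 + 1) * K') * U powr (q - 2)"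
          using sup K_le E by (meson mult_left_mono mult_right_mono order_trans less_imp_le powr_ge_zero)
        then have h_le: "h_fun \<Omega> f m \<le> E * (c0 + 1) * U powr (q - 2)"
          using K'pos m by (simp add: h_fun_def N_def[symmetric] q_def[symmetric] K'_def[symmetric] field_simps)
        have all: "h_fun \<Omega> f m \<le> C \<theta> * U powr a \<theta> * F powr b \<theta>" if \<theta>: "\<theta> \<in> {0<..1}" for \<theta>
        proof -
          \<comment> \<open>a part of the power of \<open>U\<close>, of exponent \<open>b \<theta>\<close>, is traded for a power of \<open>F\<close>\<close>
          have "U powr (q - 2) = U powr a \<theta> * U powr b \<theta>"
            by (simp add: ab(1)[OF \<theta>, symmetric] powr_add)
          also have "\<dots> \<le> U powr a \<theta> * (S * F) powr b \<theta>"
            using U U_le ab(2)[OF \<theta>] by (intro mult_left_mono powr_mono2) auto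
          also have "(S * F) powr b \<theta> = S powr b \<theta> * F powr b \<theta>"
            using S F by (simp add: powr_mult)
          finally have "E * (c0 + 1) * U powr (q - 2) \<le> E * (c0 + 1) * (U powr a \<theta> * (S powr b \<theta> * F powr b \<theta>))"
            using E \<open>c0 > 0\<close> by (intro mult_left_mono) auto
          with h_le show ?thesis
            by (simp add: C_def ac_simps)
        qed
        moreover have "h_fun \<Omega> f m \<le> C 1 * F powr b 1"
          using all[of 1] U by (simp add: ab1(1))
        ultimately show ?thesis
          using m(1) by blast
      qed
      then show "Linf_norm \<Omega> u \<le> max s0 s1 \<or>
          (Linf_norm \<Omega> u > s0 \<and>
           (\<forall>\<theta>\<in>{0<..1}. h_fun \<Omega> f (Linf_norm \<Omega> u) \<le>
                C \<theta> * Lp_norm \<Omega> q u powr a \<theta> * Lp_norm \<Omega> (2 * N / (N + 2)) (\<lambda>x. f x (u x)) powr b \<theta>) \<and>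
           h_fun \<Omega> f (Linf_norm \<Omega> u) \<le>
             C 1 * Lp_norm \<Omega> (2 * N / (N + 2)) (\<lambda>x. f x (u x)) powr b 1)"
        unfolding m_def[symmetric] F_def[symmetric] U_def[symmetric] by (meson not_le)
    qed
  qed
qed

end
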